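(* Let $d\ge 1$, let $\Gamma=(V,E)$ be a $\mathbb{Z}^d$-periodic graph, and let $D:\ell^2(V)\to \ell^2(V)$ be a linear operator of finite order which commutes with the action of $\mathbb{Z}^d$. Let $\lambda\in\mathbb{R}$ be in the pure-point spectrum of $D$ (that is, $D-\lambda I$ is not injective on $\ell^2(V)$). Put $R=\mathbb{C}[z_1^{\pm1},\dots,z_d^{\pm1}]=\mathbb{C}[\mathbb{Z}^d]$ and let $K$ be the $R$-module of all finitely supported $f:V\to\mathbb{C}$ with $Df=\lambda f$. If $$0\to R^{r_d}\to R^{r_{d-1}}\to\cdots\to R^{r_1}\to R^{r_0}\to K\to 0$$ is a finite resolution of $K$ by free $R$-modules of finite rank (an exact sequence of $R$-modules), then $$\nu(\{\lambda\})=\frac{1}{|V/\mathbb{Z}^d|}\sum_{k=0}^{d}(-1)^k r_k ,$$ where $|V/\mathbb{Z}^d|$ is the number of orbits of the action of $\mathbb{Z}^d$ on $V$.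
   Context: Graphs are simple, undirected and locally finite. For a finitely generated group $G$, a $G$-periodic graph is a graph $\Gamma=(V,E)$ with a free action of $G$ on $V$ having finitely many orbits and preserving edges: $(u,v)\in E\Rightarrow (g\cdot u,g\cdot v)\in E$. A fundamental domain $W\subset V$ is a (finite) set containing exactly one vertex from each orbit. For $g\in G$ and $f:V\to\mathbb{C}$ put $(\pi_g f)(v)=f(g^{-1}\cdot v)$. An operator $D$ on $\ell^2(V)$ commutes with the action (is periodic) if $\pi_gD=D\pi_g$ for all $g\in G$. The operator $D$ has finite order $r\in\mathbb{N}$ if for all $f,h\in\ell^2(V)$ and $v\in V$: whenever $f(w)=h(w)$ for all $w$ with $d(w,v)<r$, then $Df(v)=Dh(v)$; here $d$ is the path distance in $\Gamma$ ($\infty$ if there is no path). The space $K$ of finitely supported eigenfunctions is a module over the group algebra $\mathbb{C}[G]$ through the linear extension of $g\cdot f=\pi_g f$. Density of states: fix a fundamental domain $W$. Then $\nu(\{\lambda\})=\frac1{|W|}\operatorname{tr}(E(\{\lambda\})I_W)$, where $E(\{\lambda\})$ is the orthogonal projection of $\ell^2(V)$ onto the eigenspace $\{f\in\ell^2(V):Df=\lambda f\}$ and $I_W$ is the projection onto functions supported on $W$ ($I_Wf=f$ on $W$ and $0$ elsewhere). *)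

theory Defs
  imports
    "HOL-Analysis.Analysis"
    "HOL-Library.Extended_Nat"
    "HOL-Library.Function_Algebras"
    "HOL-Library.Poly_Mapping"
begin

definition orbits :: "('g \<Rightarrow> 'v \<Rightarrow> 'v) \<Rightarrow> 'v set set" where
  "orbits act = range (\<lambda>v. range (\<lambda>g. act g v))"

text \<open>The vertex set is the whole type \<open>'v\<close>; groups are written additively.\<close>

locale periodic_graph =
  fixes E :: "('v \<times> 'v) set"
    and act :: "'g::group_add \<Rightarrow> 'v \<Rightarrow> 'v"
  assumes edges_sym: "sym E"
    and edges_irrefl: "irrefl E"
    and locally_finite: "\<And>v. finite {w. (v, w) \<in> E}"
    and act_zero: "\<And>v. act 0 v = v"
    and act_add: "\<And>g h v. act (g + h) v = act g (act h v)"
    and act_free: "\<And>g v. act g v = v \<Longrightarrow> g = 0"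
    and finite_orbits: "finite (orbits act)"
    and act_edges: "\<And>g u v. (u, v) \<in> E \<Longrightarrow> (act g u, act g v) \<in> E"

definition fundamental_domain :: "('g \<Rightarrow> 'v \<Rightarrow> 'v) \<Rightarrow> 'v set \<Rightarrow> bool" where
  "fundamental_domain act W \<longleftrightarrow> (\<forall>B \<in> orbits act. \<exists>!w. w \<in> W \<and> w \<in> B)"

text \<open>\<open>E ^^ n\<close> relates the endpoints of walks of length \<open>n\<close>; the infimum of the empty set
  in \<^typ>\<open>enat\<close> is \<open>\<infinity>\<close>.\<close>

definition path_dist :: "('v \<times> 'v) set \<Rightarrow> 'v \<Rightarrow> 'v \<Rightarrow> enat" where
  "path_dist E u v = Inf {enat n | n. (u, v) \<in> E ^^ n}"

text \<open>Additivity and homogeneity are only required on the domain \<open>M\<close>.\<close>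

definition linear_between ::
  "('r \<Rightarrow> 'a::ab_group_add \<Rightarrow> 'a) \<Rightarrow> ('r \<Rightarrow> 'b::ab_group_add \<Rightarrow> 'b) \<Rightarrow>
    'a set \<Rightarrow> 'b set \<Rightarrow> ('a \<Rightarrow> 'b) \<Rightarrow> bool" where
  "linear_between s t M N f \<longleftrightarrow>
     f ` M \<subseteq> N \<and>
     (\<forall>x\<in>M. \<forall>y\<in>M. f (x + y) = f x + f y) \<and>
     (\<forall>a. \<forall>x\<in>M. f (s a x) = t a (f x))"

definition pointwise_scale :: "'r::times \<Rightarrow> ('i \<Rightarrow> 'r) \<Rightarrow> 'i \<Rightarrow> 'r" where
  "pointwise_scale a x = (\<lambda>i. a * x i)"

definition l2 :: "('v \<Rightarrow> complex) set" where
  "l2 = {f. (\<lambda>v. (cmod (f v))\<^sup>2) summable_on UNIV}"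

definition l2_inner :: "('v \<Rightarrow> complex) \<Rightarrow> ('v \<Rightarrow> complex) \<Rightarrow> complex" where
  "l2_inner f g = (\<Sum>\<^sub>\<infinity>v. cnj (f v) * g v)"

text \<open>An operator on \<open>\<ell>\<^sup>2(V)\<close> is a function on all of \<open>'v \<Rightarrow> complex\<close> whose values outside
  \<^const>\<open>l2\<close> are irrelevant.\<close>

definition l2_operator :: "(('v \<Rightarrow> complex) \<Rightarrow> 'v \<Rightarrow> complex) \<Rightarrow> bool" where
  "l2_operator D \<longleftrightarrow> linear_between pointwise_scale pointwise_scale l2 l2 D"

definition translate :: "('g::group_add \<Rightarrow> 'v \<Rightarrow> 'v) \<Rightarrow> 'g \<Rightarrow> ('v \<Rightarrow> complex) \<Rightarrow> 'v \<Rightarrow> complex" where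
  "translate act g f = (\<lambda>v. f (act (- g) v))"

definition commutes_with_action ::
  "('g::group_add \<Rightarrow> 'v \<Rightarrow> 'v) \<Rightarrow> (('v \<Rightarrow> complex) \<Rightarrow> 'v \<Rightarrow> complex) \<Rightarrow> bool" where
  "commutes_with_action act D \<longleftrightarrow>
     (\<forall>g. \<forall>f\<in>l2. translate act g (D f) = D (translate act g f))"

definition has_order ::
  "('v \<times> 'v) set \<Rightarrow> (('v \<Rightarrow> complex) \<Rightarrow> 'v \<Rightarrow> complex) \<Rightarrow> nat \<Rightarrow> bool" where
  "has_order E D r \<longleftrightarrow>
     (\<forall>f\<in>l2. \<forall>h\<in>l2. \<forall>v. (\<forall>w. path_dist E w v < enat r \<longrightarrow> f w = h w) \<longrightarrow> D f v = D h v)"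

definition finite_order :: "('v \<times> 'v) set \<Rightarrow> (('v \<Rightarrow> complex) \<Rightarrow> 'v \<Rightarrow> complex) \<Rightarrow> bool" where
  "finite_order E D \<longleftrightarrow> (\<exists>r. has_order E D r)"

definition point_spectrum :: "(('v \<Rightarrow> complex) \<Rightarrow> 'v \<Rightarrow> complex) \<Rightarrow> complex set" where
  "point_spectrum D = {\<mu>. \<not> inj_on (\<lambda>f. D f - pointwise_scale \<mu> f) l2}"

definition l2_eigenspace ::
  "(('v \<Rightarrow> complex) \<Rightarrow> 'v \<Rightarrow> complex) \<Rightarrow> complex \<Rightarrow> ('v \<Rightarrow> complex) set" where
  "l2_eigenspace D \<mu> = {f \<in> l2. D f = pointwise_scale \<mu> f}"

definition finsupp_eigenspace ::
  "(('v \<Rightarrow> complex) \<Rightarrow> 'v \<Rightarrow> complex) \<Rightarrow> complex \<Rightarrow> ('v \<Rightarrow> complex) set" where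
  "finsupp_eigenspace D \<mu> = {f. finite {v. f v \<noteq> 0} \<and> D f = pointwise_scale \<mu> f}"

text \<open>Meaningful when \<open>S\<close> is a closed subspace of \<^const>\<open>l2\<close> and \<open>f \<in> l2\<close>.\<close>

definition orth_proj :: "('v \<Rightarrow> complex) set \<Rightarrow> ('v \<Rightarrow> complex) \<Rightarrow> 'v \<Rightarrow> complex" where
  "orth_proj S f = (THE g. g \<in> S \<and> (\<forall>h\<in>S. l2_inner h (f - g) = 0))"

definition restrict_to :: "'v set \<Rightarrow> ('v \<Rightarrow> complex) \<Rightarrow> 'v \<Rightarrow> complex" where
  "restrict_to W f = (\<lambda>v. if v \<in> W then f v else 0)"

definition delta :: "'v \<Rightarrow> 'v \<Rightarrow> complex" where
  "delta v = (\<lambda>w. if w = v then 1 else 0)"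

text \<open>The trace of a trace class operator, computed in the orthonormal basis of delta functions.\<close>

definition l2_trace :: "(('v \<Rightarrow> complex) \<Rightarrow> 'v \<Rightarrow> complex) \<Rightarrow> complex" where
  "l2_trace T = (\<Sum>\<^sub>\<infinity>v. l2_inner (delta v) (T (delta v)))"

text \<open>The value \<open>\<nu>({\<mu>})\<close> of the density of states, for the fundamental domain \<open>W\<close>.\<close>

definition density_of_states ::
  "(('v \<Rightarrow> complex) \<Rightarrow> 'v \<Rightarrow> complex) \<Rightarrow> 'v set \<Rightarrow> complex \<Rightarrow> complex" where
  "density_of_states D W \<mu> =
     1 / of_nat (card W) * l2_trace (orth_proj (l2_eigenspace D \<mu>) \<circ> restrict_to W)"

text \<open>The group algebra \<open>\<complex>[G]\<close> is the type of finitely supported functions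
  \<open>'g \<Rightarrow>\<^sub>0 complex\<close>, whose multiplication is convolution; for \<open>G = \<int>\<^sup>d\<close> it is the ring of Laurent
  polynomials in \<open>d\<close> variables. The scalar multiplication below extends
  \<open>g \<cdot> f = translate act g f\<close> linearly.\<close>

definition group_algebra_scale ::
  "('g::group_add \<Rightarrow> 'v \<Rightarrow> 'v) \<Rightarrow> ('g \<Rightarrow>\<^sub>0 complex) \<Rightarrow> ('v \<Rightarrow> complex) \<Rightarrow> 'v \<Rightarrow> complex" where
  "group_algebra_scale act p f =
     (\<Sum>g\<in>Poly_Mapping.keys p. pointwise_scale (Poly_Mapping.lookup p g) (translate act g f))"

text \<open>\<open>R\<^sup>n\<close> as sequences vanishing from index \<open>n\<close> on, with scalar multiplication
  \<^const>\<open>pointwise_scale\<close>.\<close>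

definition free_module :: "nat \<Rightarrow> (nat \<Rightarrow> 'r::comm_ring_1) set" where
  "free_module n = {x. \<forall>i\<ge>n. x i = 0}"

definition kernel_on :: "'a set \<Rightarrow> ('a \<Rightarrow> 'b::zero) \<Rightarrow> 'a set" where
  "kernel_on M f = {x \<in> M. f x = 0}"

text \<open>For \<open>n \<ge> 1\<close>: exactness of \<open>0 \<rightarrow> R^(r n) \<rightarrow> \<dots> \<rightarrow> R^(r 1) \<rightarrow> R^(r 0) \<rightarrow> K \<rightarrow> 0\<close> with maps
  \<open>\<phi> k : R^(r k) \<rightarrow> R^(r (k - 1))\<close> and \<open>\<epsilon> : R^(r 0) \<rightarrow> K\<close>, where \<open>s\<close> is the scalar multiplication
  of \<open>K\<close>.\<close>

definition finite_free_resolution ::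
  "nat \<Rightarrow> (nat \<Rightarrow> nat) \<Rightarrow> (nat \<Rightarrow> (nat \<Rightarrow> 'r) \<Rightarrow> (nat \<Rightarrow> 'r)) \<Rightarrow>
    ((nat \<Rightarrow> 'r) \<Rightarrow> 'm) \<Rightarrow> ('r::comm_ring_1 \<Rightarrow> 'm \<Rightarrow> 'm) \<Rightarrow> 'm::ab_group_add set \<Rightarrow> bool" where
  "finite_free_resolution n r \<phi> \<epsilon> s K \<longleftrightarrow>
     linear_between pointwise_scale s (free_module (r 0)) K \<epsilon> \<and>
     (\<forall>k\<in>{1..n}. linear_between pointwise_scale pointwise_scale
        (free_module (r k)) (free_module (r (k - 1))) (\<phi> k)) \<and>
     \<epsilon> ` free_module (r 0) = K \<and>
     \<phi> 1 ` free_module (r 1) = kernel_on (free_module (r 0)) \<epsilon> \<and>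
     (\<forall>k\<in>{1..<n}. \<phi> (k + 1) ` free_module (r (k + 1)) = kernel_on (free_module (r k)) (\<phi> k)) \<and>
     kernel_on (free_module (r n)) (\<phi> n) = {0}"

end

theory Submission
  imports Defs "HOL-Real_Asymp.Real_Asymp"
begin

text \<open>For an invariant space \<open>M\<close> of finitely supported functions let its density be the limit, over
  cubes \<open>Q\<close> of radius \<open>N\<close> in \<open>\<int>\<^sup>d\<close>, of \<open>1 / |Q|\<close> times the dimension of the space of
  elements of \<open>M\<close> supported over \<open>Q\<close>. Tiling large cubes by translates of a fixed one shows that
  the limit exists and is a supremum; the same tiling shows that for an equivariant map \<open>f\<close> the image of the
  functions supported over \<open>Q\<close> already has the density of the full image of \<open>f\<close>. With rank and
  nullity over \<open>Q\<close>, the densities of kernel and image add up to the number of generators of the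
  domain, and along the exact sequence they telescope: the density of \<open>K\<close> is the
  alternating sum of the ranks.

  It remains to see that the density of \<open>K\<close> is the trace of \<open>E({\<lambda>}) I\<^sub>W\<close>. By invariance the trace over
  the block of a cube \<open>Q\<close> is \<open>|Q|\<close> times the trace over \<open>W\<close>. It is at least the dimension of the
  subspace of eigenfunctions supported in the block, and at most the dimension of the restrictions of all
  eigenfunctions to the block. Restrictions that vanish near the boundary of the block are
  themselves eigenfunctions, so the two bounds differ by at most the number of boundary vertices,
  which is \<open>o(|Q|)\<close>.\<close>

subsection \<open>Dimensions of spaces of finitely supported functions\<close>

context vector_space
begin

text \<open>An infinite basis has \<open>card\<close> 0, so \<open>dim\<close> is monotone only
  below a finite-dimensional space; the finite set \<open>B\<close> provides such a bound.\<close>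

lemma dim_mono_finite:
  assumes "U \<subseteq> V" "V \<subseteq> span B" "finite B"
  shows "dim U \<le> dim V"
proof -
  obtain b where b: "b \<subseteq> V" "independent b" "V \<subseteq> span b" "card b = dim V"
    using basis_exists by blast
  have "finite b"
    using b assms independent_span_bound[of B b] by blast
  moreover have "U \<subseteq> span b" using assms b by blast
  ultimately show ?thesis using b dim_le_card by metis
qed

lemma span_Int_independent_disjoint:
  assumes "independent (A \<union> B)" "A \<inter> B = {}" "finite A" "finite B"
    and "x \<in> span A" "x \<in> span B"
  shows "x = 0"
proof -
  obtain u where u: "x = (\<Sum>v\<in>A. scale (u v) v)"
    using assms span_finite[of A] by auto
  obtain w where w: "x = (\<Sum>v\<in>B. scale (w v) v)"
    using assms span_finite[of B] by auto
  \<comment> \<open>Writing \<open>x\<close> through \<open>A\<close> and \<open>- x\<close> through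
    \<open>B\<close> turns the two expansions into one linear relation on
    \<open>A \<union> B\<close>.\<close>
  define z where "z v = (if v \<in> A then u v else - w v)" for v
  have "(\<Sum>v\<in>A \<union> B. scale (z v) v) = (\<Sum>v\<in>A. scale (z v) v) + (\<Sum>v\<in>B. scale (z v) v)"
    using assms by (intro sum.union_disjoint) auto
  also have "(\<Sum>v\<in>A. scale (z v) v) = x"
    unfolding u by (rule sum.cong) (auto simp: z_def)
  also have "(\<Sum>v\<in>B. scale (z v) v) = - x"
    unfolding w sum_negf[symmetric] using assms(2)
    by (intro sum.cong) (auto simp: z_def scale_minus_left)
  finally have "(\<Sum>v\<in>A \<union> B. scale (z v) v) = 0" by simp
  then have "z v = 0" if "v \<in> A" for v
    using independentD[OF assms(1), of "A \<union> B" z v] assms that by blast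
  then have "u v = 0" if "v \<in> A" for v
    using that by (auto simp: z_def)
  then show ?thesis unfolding u by simp
qed

end

section \<open>Rank and nullity for spaces of complex-valued functions\<close>

interpretation cfun: vector_space "pointwise_scale :: complex \<Rightarrow> ('x \<Rightarrow> complex) \<Rightarrow> 'x \<Rightarrow> complex"
  by unfold_locales (auto simp: pointwise_scale_def fun_eq_iff algebra_simps)

interpretation cfun_pair: vector_space_pair
  "pointwise_scale :: complex \<Rightarrow> ('x \<Rightarrow> complex) \<Rightarrow> 'x \<Rightarrow> complex"
  "pointwise_scale :: complex \<Rightarrow> ('y \<Rightarrow> complex) \<Rightarrow> 'y \<Rightarrow> complex"
  by unfold_locales

abbreviation clinear_on ::
  "('x \<Rightarrow> complex) set \<Rightarrow> (('x \<Rightarrow> complex) \<Rightarrow> 'y \<Rightarrow> complex) \<Rightarrow> bool" where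
  "clinear_on U \<equiv> linear_between pointwise_scale pointwise_scale U UNIV"

lemma clinear_onD:
  assumes "clinear_on U f"
  shows "x \<in> U \<Longrightarrow> y \<in> U \<Longrightarrow> f (x + y) = f x + f y"
    and "x \<in> U \<Longrightarrow> f (pointwise_scale a x) = pointwise_scale a (f x)"
  using assms by (auto simp: linear_between_def)

lemma clinear_on_subset: "clinear_on V f \<Longrightarrow> U \<subseteq> V \<Longrightarrow> clinear_on U f"
  unfolding linear_between_def by blast

lemma clinear_on_0:
  assumes "clinear_on U f" "cfun.subspace U"
  shows "f 0 = 0"
  using clinear_onD(2)[OF assms(1), of 0 0] assms(2) cfun.subspace_0 by fastforce

lemma clinear_on_sum:
  assumes "clinear_on U f" "cfun.subspace U" "\<And>i. i \<in> I \<Longrightarrow> g i \<in> U"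
  shows "f (\<Sum>i\<in>I. g i) = (\<Sum>i\<in>I. f (g i))"
  using assms(3)
proof (induction I rule: infinite_finite_induct)
  case (insert i I)
  have "f (g i + (\<Sum>i\<in>I. g i)) = f (g i) + f (\<Sum>i\<in>I. g i)"
    using insert.prems by (intro clinear_onD(1)[OF assms(1)] cfun.subspace_sum[OF assms(2)]) auto
  then show ?case
    using insert.IH insert.prems unfolding sum.insert[OF insert.hyps] by (metis insertCI)
qed (simp_all add: clinear_on_0[OF assms(1,2)])

lemma subspace_clinear_image:
  assumes "clinear_on U f" "cfun.subspace U"
  shows "cfun.subspace (f ` U)"
proof (rule cfun.subspaceI)
  show "0 \<in> f ` U"
    using clinear_on_0[OF assms] cfun.subspace_0[OF assms(2)] by (metis imageI)
next
  fix x y assume "x \<in> f ` U" "y \<in> f ` U"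
  then show "x + y \<in> f ` U"
    using clinear_onD(1)[OF assms(1)] cfun.subspace_add[OF assms(2)] by (smt (verit) imageE imageI)
next
  fix c x assume "x \<in> f ` U"
  then show "pointwise_scale c x \<in> f ` U"
    using clinear_onD(2)[OF assms(1)] cfun.subspace_scale[OF assms(2)] by (smt (verit) imageE imageI)
qed

lemma subspace_clinear_kernel:
  assumes "clinear_on U f" "cfun.subspace U"
  shows "cfun.subspace (kernel_on U f)"
  unfolding kernel_on_def
  by (rule cfun.subspaceI)
    (use assms in \<open>auto simp: clinear_onD[OF assms(1)] clinear_on_0[OF assms]
       intro!: cfun.subspace_add cfun.subspace_scale cfun.subspace_0\<close>)

text \<open>A basis \<open>b\<close> of the kernel is extended to a basis \<open>b'\<close> of
  \<open>U\<close>; the map is injective on the span of the added vectors \<open>c\<close>, and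
  their images span the image.\<close>

lemma dim_kernel_plus_dim_image:
  fixes f :: "('x \<Rightarrow> complex) \<Rightarrow> 'y \<Rightarrow> complex"
  assumes f: "clinear_on U f" and U: "cfun.subspace U" "U \<subseteq> cfun.span B" "finite B"
  shows "cfun.dim (kernel_on U f) + cfun.dim (f ` U) = cfun.dim U"
proof -
  obtain b where b: "b \<subseteq> kernel_on U f" "cfun.independent b" "kernel_on U f \<subseteq> cfun.span b"
    "card b = cfun.dim (kernel_on U f)"
    using cfun.basis_exists by blast
  have "b \<subseteq> U" using b by (auto simp: kernel_on_def)
  then obtain b' where b': "b \<subseteq> b'" "b' \<subseteq> U" "cfun.independent b'" "U \<subseteq> cfun.span b'"
    using cfun.maximal_independent_subset_extend b(2) by blast
  define c where "c = b' - b"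
  have fin: "finite b'" using cfun.independent_span_bound[OF U(3) b'(3)] b'(2) U(2) by auto
  have spanU: "cfun.span b' = U" using b'(2,4) U(1) by (rule cfun.span_subspace)
  have b'c: "b' = c \<union> b" using b' by (auto simp: c_def)
  \<comment> \<open>\<open>f\<close> is linear only on \<open>U\<close>; a globally linear
    \<open>g\<close> that agrees with it on the basis takes its place, and the next step shows that
    both coincide on \<open>U\<close>.\<close>
  obtain g where g: "Vector_Spaces.linear pointwise_scale pointwise_scale g" "\<forall>x\<in>b'. g x = f x"
    using cfun_pair.linear_independent_extend[OF b'(3)] by blast
  have gf: "g x = f x" if "x \<in> U" for x
  proof -
    have "x \<in> cfun.span b'" using that spanU by simp
    then have "x \<in> U \<and> g x = f x"
    proof (induction rule: cfun.span_induct_alt)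
      case base
      then show ?case
        using cfun.subspace_0[OF U(1)] cfun_pair.linear_0[OF g(1)] clinear_on_0[OF f U(1)] by metis
    next
      case (step a x y)
      have "x \<in> U" using step b' by auto
      then have ax: "pointwise_scale a x \<in> U"
        by (rule cfun.subspace_scale[OF U(1)])
      have "g (pointwise_scale a x) = f (pointwise_scale a x)"
        using clinear_onD(2)[OF f \<open>x \<in> U\<close>] cfun_pair.linear_scale[OF g(1)] g(2) step(1) by metis
      then have "g (pointwise_scale a x + y) = f (pointwise_scale a x + y)"
        using clinear_onD(1)[OF f ax] cfun_pair.linear_add[OF g(1)] step(2) by metis
      then show ?case
        using cfun.subspace_add[OF U(1) ax] step(2) by blast
    qed
    then show ?thesis by simp
  qed
  have ker0: "x = 0" if "x \<in> cfun.span c" "g x = 0" for x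
  proof -
    have "x \<in> U" using that(1) spanU b'c cfun.span_mono[of c b'] by auto
    then have "x \<in> kernel_on U f" using gf that(2) by (simp add: kernel_on_def)
    then have "x \<in> cfun.span b" using b(3) by auto
    moreover have "finite c" "finite b" using fin b'c by auto
    moreover have "c \<inter> b = {}" by (auto simp: c_def)
    ultimately show ?thesis
      using cfun.span_Int_independent_disjoint[of c b x] that(1) b'(3) unfolding b'c by blast
  qed
  have inj: "inj_on g (cfun.span c)"
    using cfun_pair.linear_inj_on_iff_eq_0[OF g(1)] ker0 cfun.subspace_span by metis
  have "cfun.independent (g ` c)"
    using cfun.independent_mono[OF b'(3)] b'c
    by (intro cfun_pair.linear_independent_injective_image[OF g(1) _ inj]) auto
  moreover have "cfun.span (g ` c) = cfun.span (f ` U)"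
  proof -
    have gb: "g ` b \<subseteq> {0}" using b(1) gf by (auto simp: kernel_on_def)
    have "f ` U = g ` U" using gf by auto
    also have "\<dots> = cfun.span (g ` b')"
      using cfun_pair.linear_span_image[OF g(1)] spanU by simp
    also have "\<dots> = cfun.span (g ` c)"
    proof -
      have "g ` b' \<subseteq> insert 0 (g ` c)" "g ` c \<subseteq> g ` b'" using gb b'c by auto
      then show ?thesis
        by (metis cfun.span_insert_0 cfun.span_mono subset_antisym)
    qed
    finally show ?thesis by (simp add: cfun.span_span)
  qed
  ultimately have "cfun.dim (f ` U) = card (g ` c)"
    by (intro cfun.dim_eq_card) auto
  also have "\<dots> = card c"
    using inj cfun.span_superset[of c] by (intro card_image) (rule inj_on_subset)
  finally have 1: "cfun.dim (f ` U) = card c" .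
  have "cfun.dim U = card b'"
    using cfun.basis_card_eq_dim[OF b'(2,4,3)] by simp
  also have "\<dots> = card b + card c"
    using fin b'(1) by (simp add: c_def card_Diff_subset finite_subset card_mono)
  finally show ?thesis using 1 b(4) by simp
qed

section \<open>Functions supported on a finite set\<close>

definition supported_on :: "'x set \<Rightarrow> ('x \<Rightarrow> complex) set" where
  "supported_on A = {f. \<forall>x. x \<notin> A \<longrightarrow> f x = 0}"

lemma supported_on_mono: "A \<subseteq> B \<Longrightarrow> supported_on A \<subseteq> supported_on B"
  by (auto simp: supported_on_def)

lemma subspace_supported_on [simp]: "cfun.subspace (supported_on A)"
  by (auto simp: supported_on_def cfun.subspace_def pointwise_scale_def)

lemma sum_fun_apply: "(\<Sum>i\<in>I. f i) x = (\<Sum>i\<in>I. f i x)"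
  for f :: "'i \<Rightarrow> 'x \<Rightarrow> 'a::comm_monoid_add"
  by (induction I rule: infinite_finite_induct) simp_all

lemma supported_on_expand:
  assumes "finite A" "f \<in> supported_on A"
  shows "f = (\<Sum>a\<in>A. pointwise_scale (f a) (delta a))"
proof
  fix x
  have "(\<Sum>a\<in>A. pointwise_scale (f a) (delta a)) x = (\<Sum>a\<in>A. if x = a then f a else 0)"
    unfolding sum_fun_apply by (intro sum.cong) (auto simp: pointwise_scale_def delta_def)
  then show "f x = (\<Sum>a\<in>A. pointwise_scale (f a) (delta a)) x"
    using assms by (auto simp: supported_on_def)
qed

lemma supported_on_span:
  assumes "finite A"
  shows "supported_on A \<subseteq> cfun.span (delta ` A)"
proof
  fix f assume "f \<in> supported_on A"
  then have "f = (\<Sum>a\<in>A. pointwise_scale (f a) (delta a))"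
    using supported_on_expand[OF assms] by simp
  then show "f \<in> cfun.span (delta ` A)"
    by (metis (no_types, lifting) cfun.span_sum cfun.span_scale cfun.span_base imageI)
qed

lemma inj_delta: "inj delta"
  by (auto simp: inj_on_def delta_def fun_eq_iff split: if_splits)

lemma independent_deltas:
  assumes "finite A"
  shows "cfun.independent (delta ` A)"
proof (rule cfun.independent_if_scalars_zero)
  fix c v assume 0: "(\<Sum>x\<in>delta ` A. pointwise_scale (c x) x) = 0" and v: "v \<in> delta ` A"
  then obtain a where a: "a \<in> A" "v = delta a" by auto
  have "0 = (\<Sum>x\<in>A. pointwise_scale (c (delta x)) (delta x)) a"
    using 0 by (subst (asm) sum.reindex) (auto intro: inj_on_subset[OF inj_delta])
  also have "\<dots> = (\<Sum>x\<in>A. if a = x then c (delta x) else 0)"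
    unfolding sum_fun_apply by (intro sum.cong) (auto simp: pointwise_scale_def delta_def)
  finally show "c v = 0" using a assms by auto
qed (use assms in auto)

lemma dim_supported_on:
  assumes "finite A"
  shows "cfun.dim (supported_on A) = card A"
proof -
  have "card (delta ` A) = cfun.dim (supported_on A)"
    using independent_deltas[OF assms] supported_on_span[OF assms]
    by (intro cfun.basis_card_eq_dim) (auto simp: supported_on_def delta_def)
  then show ?thesis
    using card_image[OF inj_on_subset[OF inj_delta, of A]] by simp
qed

lemma dim_mono_supported:
  assumes "U \<subseteq> V" "V \<subseteq> supported_on A" "finite A"
  shows "cfun.dim U \<le> cfun.dim V"
  using assms supported_on_span[OF assms(3)]
  by (intro cfun.dim_mono_finite[of U V "delta ` A"]) auto

lemma dim_le_card_supported:
  assumes "U \<subseteq> supported_on A" "finite A"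
  shows "cfun.dim U \<le> card A"
  using dim_mono_supported[OF assms(1) order_refl assms(2)] dim_supported_on[OF assms(2)] by simp

lemma dim_image_kernel_supported:
  assumes "clinear_on U f" "cfun.subspace U" "U \<subseteq> supported_on A" "finite A"
  shows "cfun.dim (kernel_on U f) + cfun.dim (f ` U) = cfun.dim U"
  using assms supported_on_span[OF assms(4)]
  by (intro dim_kernel_plus_dim_image[of U f "delta ` A"]) auto

lemma dim_injective_image_supported:
  assumes "clinear_on U f" "cfun.subspace U" "U \<subseteq> supported_on A" "finite A"
    and "\<And>x. x \<in> U \<Longrightarrow> f x = 0 \<Longrightarrow> x = 0"
  shows "cfun.dim (f ` U) = cfun.dim U"
proof -
  have "kernel_on U f \<subseteq> {0}" using assms(5) by (auto simp: kernel_on_def)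
  then have "kernel_on U f \<subseteq> cfun.span {}" by simp
  then have "cfun.dim (kernel_on U f) = 0"
    using cfun.dim_le_card[of "kernel_on U f" "{}"] by simp
  then show ?thesis using dim_image_kernel_supported[OF assms(1-4)] by simp
qed

lemma clinear_on_restrict_to: "clinear_on U (restrict_to A)"
  by (auto simp: linear_between_def restrict_to_def pointwise_scale_def fun_eq_iff)

text \<open>Restriction to one of the disjoint supports \<open>Y j\<close> separates
  \<open>U j\<close> from the rest: \<open>U j\<close> lies in the image of this restriction, the
  remaining \<open>U i\<close> in its kernel. Rank and nullity then give the induction step.\<close>

lemma sum_dim_disjoint_supports_le:
  assumes "finite J" "cfun.subspace S" "S \<subseteq> supported_on A" "finite A"
    and "\<And>j. j \<in> J \<Longrightarrow> cfun.subspace (U j)" "\<And>j. j \<in> J \<Longrightarrow> U j \<subseteq> S"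
    and "\<And>j. j \<in> J \<Longrightarrow> U j \<subseteq> supported_on (Y j)"
    and "disjoint_family_on Y J"
  shows "(\<Sum>j\<in>J. cfun.dim (U j)) \<le> cfun.dim S"
  using assms
proof (induction J arbitrary: S rule: finite_induct)
  case (insert j J)
  define T where "T = kernel_on S (restrict_to (Y j))"
  have TS: "T \<subseteq> S" by (auto simp: T_def kernel_on_def)
  have T0: "cfun.subspace T" unfolding T_def
    using insert by (intro subspace_clinear_kernel clinear_on_restrict_to) auto
  have UT: "U i \<subseteq> T" if "i \<in> J" for i
  proof -
    have "U i \<subseteq> S" "U i \<subseteq> supported_on (Y i)" "Y i \<inter> Y j = {}"
      using insert.prems that insert.hyps by (auto simp: disjoint_family_on_def)
    then show ?thesis
      by (fastforce simp: T_def kernel_on_def restrict_to_def supported_on_def fun_eq_iff)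
  qed
  have TA: "T \<subseteq> supported_on A" using TS insert.prems(2) by blast
  have "(\<Sum>i\<in>J. cfun.dim (U i)) \<le> cfun.dim T"
    by (rule insert.IH[OF T0 TA]) (use insert.prems UT in \<open>auto simp: disjoint_family_on_def\<close>)
  moreover have "cfun.dim (U j) \<le> cfun.dim (restrict_to (Y j) ` S)"
  proof (rule dim_mono_supported)
    have "f = restrict_to (Y j) f" if "f \<in> U j" for f
      using insert.prems(6)[of j] that by (force simp: supported_on_def restrict_to_def)
    then show "U j \<subseteq> restrict_to (Y j) ` S"
      using insert.prems(5)[of j] by auto
    show "restrict_to (Y j) ` S \<subseteq> supported_on A"
      using insert.prems(2) by (auto simp: supported_on_def restrict_to_def)
  qed (use insert in auto)
  ultimately show ?case
    using dim_image_kernel_supported[OF clinear_on_restrict_to insert.prems(1-3), of "Y j"] insert.hyps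
    by (simp add: T_def)
qed auto

subsection \<open>Cubes\<close>

definition cube :: "nat \<Rightarrow> (int ^ 'd::finite) set" where
  "cube N = {g. \<forall>i. \<bar>g $ i\<bar> \<le> int N}"

definition cube_vol :: "nat \<Rightarrow> nat \<Rightarrow> real" where
  "cube_vol d N = (2 * real N + 1) ^ d"

lemma cube_vol_pos [simp]: "cube_vol d N > 0"
  by (simp add: cube_vol_def add_pos_nonneg)

lemma cube_eq_image: "(cube N :: (int ^ 'd::finite) set) = vec_lambda ` (UNIV \<rightarrow>\<^sub>E {- int N..int N})"
    (is "?L = ?R")
proof (rule subset_antisym)
  show "?L \<subseteq> ?R"
  proof
    fix g :: "int ^ 'd" assume "g \<in> cube N"
    then have "vec_nth g \<in> UNIV \<rightarrow>\<^sub>E {- int N..int N}"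
      by (auto simp: cube_def abs_le_iff PiE_iff minus_le_iff)
    then show "g \<in> vec_lambda ` (UNIV \<rightarrow>\<^sub>E {- int N..int N})"
      by (metis image_eqI vec_nth_inverse)
  qed
qed (auto simp: cube_def PiE_iff abs_le_iff minus_le_iff)

lemma card_cube_nat: "card (cube N :: (int ^ 'd::finite) set) = (2 * N + 1) ^ CARD('d)"
proof -
  have "inj_on vec_lambda (UNIV \<rightarrow>\<^sub>E {- int N..int N} :: ('d \<Rightarrow> int) set)"
    by (auto simp: inj_on_def vec_lambda_inject)
  from card_image[OF this] have "card (cube N :: (int ^ 'd) set) = card (UNIV \<rightarrow>\<^sub>E {- int N..int N} :: ('d \<Rightarrow> int) set)"
    unfolding cube_eq_image .
  also have "\<dots> = card {- int N..int N} ^ CARD('d)"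
    by (subst card_PiE) auto
  also have "card {- int N..int N} = 2 * N + 1" by simp
  finally show ?thesis .
qed

lemma finite_cube [simp]: "finite (cube N)"
  unfolding cube_eq_image by (intro finite_imageI finite_PiE) auto

lemma card_cube: "real (card (cube N :: (int ^ 'd::finite) set)) = cube_vol CARD('d) N"
  unfolding card_cube_nat cube_vol_def by (simp add: add.commute)

lemma cube_mono: "M \<le> N \<Longrightarrow> cube M \<subseteq> cube N"
  unfolding cube_def by (auto intro: order_trans)

lemma cube_zero: "0 \<in> cube N"
  by (simp add: cube_def)

lemma cube_add: "g \<in> cube M \<Longrightarrow> h \<in> cube N \<Longrightarrow> g + h \<in> cube (M + N)"
  unfolding cube_def by (auto intro: order_trans[OF abs_triangle_ineq] add_mono)

lemma cube_uminus: "g \<in> cube N \<Longrightarrow> - g \<in> cube N"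
  by (simp add: cube_def)

lemma cube_exhausts: "\<exists>N. g \<in> cube N"
proof
  have "nat \<bar>g $ i\<bar> \<le> (\<Sum>i\<in>UNIV. nat \<bar>g $ i\<bar>)" for i
    by (rule member_le_sum) auto
  then show "g \<in> cube (\<Sum>i\<in>UNIV. nat \<bar>g $ i\<bar>)"
    unfolding cube_def mem_Collect_eq using nat_le_iff by blast
qed

lemma cube_exhausts_finite:
  assumes "finite A"
  shows "\<exists>N. A \<subseteq> cube N"
  using assms
proof (induction A rule: finite_induct)
  case (insert g A)
  then obtain N where N: "A \<subseteq> cube N" by auto
  obtain M where M: "g \<in> cube M" using cube_exhausts by blast
  have "insert g A \<subseteq> cube (max M N)"
    using M N cube_mono[of M "max M N"] cube_mono[of N "max M N"] by auto
  then show ?case by blast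
qed auto

text \<open>Coordinatewise two points of the cube differ by at most \<open>2 * N\<close>, while
  distinct tile centres differ by a multiple of \<open>2 * N + 1\<close> that is nonzero in some
  coordinate.\<close>

lemma cube_tile_disjoint:
  assumes "g \<in> cube N" "g' \<in> cube N"
    and "int (2 * N + 1) *s j + g = int (2 * N + 1) *s j' + g'"
  shows "j = j'"
proof -
  have "j $ i = j' $ i" for i
  proof (rule ccontr)
    assume ne: "j $ i \<noteq> j' $ i"
    have "\<bar>g $ i\<bar> \<le> int N" "\<bar>g' $ i\<bar> \<le> int N" using assms by (auto simp: cube_def)
    then have "\<bar>g' $ i - g $ i\<bar> \<le> 2 * int N" by linarith
    moreover have *: "int (2 * N + 1) * (j $ i - j' $ i) = g' $ i - g $ i"
      using arg_cong[OF assms(3), of "\<lambda>x. x $ i"] by (simp add: algebra_simps)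
    moreover have "int (2 * N + 1) * 1 \<le> int (2 * N + 1) * \<bar>j $ i - j' $ i\<bar>"
      using ne by (intro mult_left_mono) auto
    then have "int (2 * N + 1) \<le> \<bar>g' $ i - g $ i\<bar>"
      unfolding *[symmetric] abs_mult abs_of_nat by simp
    ultimately show False by linarith
  qed
  then show ?thesis by (simp add: vec_eq_iff)
qed

lemma affine_ratio_tendsto: "(\<lambda>N. (2 * real N + a) / (2 * real N + b)) \<longlonglongrightarrow> 1"
  by real_asymp

lemma cube_vol_shift: "(\<lambda>N. cube_vol d (N + c) / cube_vol d N) \<longlonglongrightarrow> 1"
proof -
  have "(\<lambda>N. ((2 * real N + (2 * real c + 1)) / (2 * real N + 1)) ^ d) \<longlonglongrightarrow> 1 ^ d"
    by (intro tendsto_power affine_ratio_tendsto)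
  then show ?thesis by (simp add: cube_vol_def power_divide algebra_simps)
qed

lemma cube_vol_boundary: "(\<lambda>N. (cube_vol d N - cube_vol d (N - c)) / cube_vol d N) \<longlonglongrightarrow> 0"
proof -
  have "(\<lambda>N. 1 / (cube_vol d (N + c) / cube_vol d N)) \<longlonglongrightarrow> 1 / 1"
    by (intro tendsto_divide cube_vol_shift tendsto_const) auto
  then have "(\<lambda>N. 1 - cube_vol d N / cube_vol d (N + c)) \<longlonglongrightarrow> 1 - 1"
    by (intro tendsto_diff tendsto_const) simp
  \<comment> \<open>Replacing \<open>N\<close> by \<open>N + c\<close> makes the truncated
    subtraction harmless, since \<open>N + c - c\<close> is \<open>N\<close>; the offset is removed
    at the end.\<close>
  then have "(\<lambda>N. (cube_vol d (N + c) - cube_vol d (N + c - c)) / cube_vol d (N + c)) \<longlonglongrightarrow> 0"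
    by (simp add: diff_divide_distrib less_imp_neq[OF cube_vol_pos, symmetric])
  then show ?thesis
    by (rule LIMSEQ_offset[of "\<lambda>N. (cube_vol d N - cube_vol d (N - c)) / cube_vol d N" c])
qed

text \<open>The cube of radius \<open>(2 m + 1) k + m\<close> is tiled by \<open>(2 k + 1)\<^sup>d\<close> translates of the cube of
  radius \<open>m\<close>; below, \<open>f N\<close> is a dimension over the cube of radius \<open>N\<close>, and the margin \<open>c\<close> leaves
  room for preimages whose support is larger than the tile.\<close>

lemma tiling_density_lower_bound:
  assumes mono: "mono f" and A: "A \<ge> 0"
    and tile: "\<And>k. cube_vol d k * A \<le> f ((2 * m + 1) * k + m + c)"
    and "e > 0"
  shows "\<forall>\<^sub>F N in sequentially. A / cube_vol d m - e < f N / cube_vol d N"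
proof -
  \<comment> \<open>\<open>?b\<close> is chosen so that, for the largest \<open>k\<close> with
    \<open>?n * k + m + c \<le> N\<close>, the bound \<open>N \<le> ?n * k + ?n + m + c\<close>
    becomes \<open>2 * N + ?b \<le> ?n * (2 * k + 1)\<close>.\<close>
  let ?n = "2 * m + 1" and ?b = "1 - 2 * (2 * real m + 1) - 2 * real c"
  have "(\<lambda>N. A / cube_vol d m * ((2 * real N + ?b) / (2 * real N + 1)) ^ d)
    \<longlonglongrightarrow> A / cube_vol d m * 1 ^ d"
    by (intro tendsto_intros affine_ratio_tendsto)
  then have ev: "\<forall>\<^sub>F N in sequentially. A / cube_vol d m - e <
      A / cube_vol d m * ((2 * real N + ?b) / (2 * real N + 1)) ^ d"
    using \<open>e > 0\<close> by (intro order_tendstoD(1)[where y = "A / cube_vol d m"]) auto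
  \<comment> \<open>The lower bound on \<open>N\<close> keeps \<open>N - m - c\<close> from being
    truncated and makes the base \<open>2 * N + ?b\<close> nonnegative, as monotonicity of powers
    requires.\<close>
  show ?thesis
    using ev eventually_ge_at_top[of "2 * ?n + m + c"]
  proof eventually_elim
    case (elim N)
    define k where "k = (N - m - c) div ?n"
    have k1: "?n * k + m + c \<le> N"
      using elim(2) div_times_less_eq_dividend[of "N - m - c" ?n] by (simp add: k_def mult.commute)
    have "N - m - c < ?n * k + ?n"
      using mod_less_divisor[of ?n "N - m - c"] div_mult_mod_eq[of "N - m - c" ?n]
      by (metis add_strict_left_mono k_def mult.commute zero_less_Suc Suc_eq_plus1)
    then have k2: "N < ?n * k + ?n + m + c" by linarith
    have "2 * real N + ?b \<le> (2 * real m + 1) * (2 * real k + 1)"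
    proof -
      have "real N \<le> real (?n * k + ?n + m + c)" using k2 by linarith
      then show ?thesis by (simp add: algebra_simps)
    qed
    moreover have "0 \<le> 2 * real N + ?b"
    proof -
      have "real (2 * ?n + m + c) \<le> real N" using elim(2) by linarith
      then show ?thesis by (simp add: algebra_simps)
    qed
    ultimately have "(2 * real N + ?b) ^ d \<le> cube_vol d m * cube_vol d k"
      unfolding cube_vol_def power_mult_distrib[symmetric] by (rule power_mono)
    then have "A / cube_vol d m * (2 * real N + ?b) ^ d \<le> A / cube_vol d m * (cube_vol d m * cube_vol d k)"
      using A by (intro mult_left_mono) (auto simp: less_imp_le)
    also have "\<dots> = cube_vol d k * A"
      by (simp add: less_imp_neq[OF cube_vol_pos, symmetric])
    also have "\<dots> \<le> f (?n * k + m + c)" by (rule tile)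
    also have "\<dots> \<le> f N" using k1 mono by (auto simp: mono_def)
    finally have "A / cube_vol d m * (2 * real N + ?b) ^ d / cube_vol d N \<le> f N / cube_vol d N"
      by (intro divide_right_mono) (auto simp: less_imp_le)
    then have "A / cube_vol d m * ((2 * real N + ?b) / (2 * real N + 1)) ^ d \<le> f N / cube_vol d N"
      unfolding power_divide by (simp add: cube_vol_def[of d N])
    then show ?case using elim(1) by linarith
  qed
qed

subsection \<open>Density of invariant subspaces\<close>

text \<open>\<open>W\<close> holds one representative of each orbit that it meets, and
  \<open>act_eqD\<close> combines this with freeness. The orbits of \<open>W\<close> need not cover
  the type: this lets one locale serve the vertices of the graph and free modules of different
  ranks.\<close>

locale free_cofinite_action =
  fixes act :: "int ^ 'd::finite \<Rightarrow> 'x \<Rightarrow> 'x" and W :: "'x set"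
  assumes act_zero: "act 0 x = x"
    and act_add: "act (g + h) x = act g (act h x)"
    and finite_W: "finite W"
    and act_eqD: "w \<in> W \<Longrightarrow> w' \<in> W \<Longrightarrow> act g w = act h w' \<Longrightarrow> g = h \<and> w = w'"
begin

definition block :: "nat \<Rightarrow> 'x set" where
  "block N = (\<lambda>(g, w). act g w) ` (cube N \<times> W)"

definition finsupp :: "('x \<Rightarrow> complex) set" where
  "finsupp = (\<Union>N. supported_on (block N))"

lemma act_uminus [simp]: "act (- g) (act g x) = x" "act g (act (- g) x) = x"
  using act_add[of "- g" g x] act_add[of g "- g" x] act_zero by simp_all

lemma block_memI: "g \<in> cube N \<Longrightarrow> w \<in> W \<Longrightarrow> act g w \<in> block N"
  by (auto simp: block_def)

lemma finite_block [simp]: "finite (block N)"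
  by (simp add: block_def finite_W)

lemma card_block: "real (card (block N)) = card W * cube_vol CARD('d) N"
proof -
  have "inj_on (\<lambda>(g, w). act g w) (cube N \<times> W)"
    using act_eqD by (fastforce simp: inj_on_def)
  then have "card (block N) = card (cube N :: (int ^ 'd) set) * card W"
    unfolding block_def by (simp add: card_image card_cartesian_product)
  then show ?thesis by (simp add: card_cube mult.commute)
qed

lemma block_mono: "M \<le> N \<Longrightarrow> block M \<subseteq> block N"
  unfolding block_def using cube_mono by (intro image_mono Sigma_mono) auto

lemma act_block_subset: "g \<in> cube M \<Longrightarrow> act g ` block N \<subseteq> block (M + N)"
  by (auto simp: block_def act_add[symmetric] intro!: block_memI[unfolded block_def] image_eqI cube_add)

lemma supported_block_mono: "M \<le> N \<Longrightarrow> supported_on (block M) \<subseteq> supported_on (block N)"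
  by (intro supported_on_mono block_mono)

lemma supported_block_subset_finsupp: "supported_on (block N) \<subseteq> finsupp"
  by (auto simp: finsupp_def)

lemma supported_block_common:
  assumes "finite I" "\<And>i. i \<in> I \<Longrightarrow> f i \<in> finsupp"
  shows "\<exists>N. \<forall>i\<in>I. f i \<in> supported_on (block N)"
  using assms
proof (induction I rule: finite_induct)
  case (insert i I)
  then obtain N where N: "\<forall>i\<in>I. f i \<in> supported_on (block N)" by auto
  obtain M where M: "f i \<in> supported_on (block M)" using insert.prems by (auto simp: finsupp_def)
  have "\<forall>j\<in>insert i I. f j \<in> supported_on (block (max M N))"
    using M N supported_block_mono[of M "max M N"] supported_block_mono[of N "max M N"] by auto
  then show ?case by blast
qed auto

lemma subspace_finsupp [simp]: "cfun.subspace finsupp"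
proof (rule cfun.subspaceI)
  show "0 \<in> finsupp"
    using supported_block_subset_finsupp cfun.subspace_0[OF subspace_supported_on] by blast
next
  fix f g assume "f \<in> finsupp" "g \<in> finsupp"
  then obtain N where "\<forall>h\<in>{f, g}. h \<in> supported_on (block N)"
    using supported_block_common[of "{f, g}" "\<lambda>h. h"] by auto
  then show "f + g \<in> finsupp"
    using supported_block_subset_finsupp cfun.subspace_add[OF subspace_supported_on] by blast
next
  fix c f assume "f \<in> finsupp"
  then show "pointwise_scale c f \<in> finsupp"
    unfolding finsupp_def using cfun.subspace_scale[OF subspace_supported_on] by blast
qed

lemma clinear_on_translate: "clinear_on U (translate act g)"
  by (auto simp: linear_between_def translate_def pointwise_scale_def fun_eq_iff)

lemma translate_eq_0D: "translate act g f = 0 \<Longrightarrow> f = 0"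
  by (metis act_uminus(1) translate_def zero_fun_apply ext)

lemma translate_delta: "translate act g (delta x) = delta (act g x)"
proof
  fix v
  have "act (- g) v = x \<longleftrightarrow> v = act g x" by auto
  then show "translate act g (delta x) v = delta (act g x) v"
    by (simp add: translate_def delta_def)
qed

lemma translate_supported: "f \<in> supported_on A \<Longrightarrow> translate act g f \<in> supported_on (act g ` A)"
  unfolding supported_on_def translate_def by (auto simp: image_iff) (metis act_uminus(2))

lemma translate_supported_block:
  "g \<in> cube M \<Longrightarrow> f \<in> supported_on (block N) \<Longrightarrow> translate act g f \<in> supported_on (block (M + N))"
  using translate_supported[of f "block N" g] supported_on_mono[OF act_block_subset[of g M N]] by auto

lemma translate_finsupp: "f \<in> finsupp \<Longrightarrow> translate act g f \<in> finsupp"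
  using cube_exhausts[of g] translate_supported_block unfolding finsupp_def by blast

lemma tile_disjoint:
  "disjoint_family_on (\<lambda>j. act (int (2 * N + 1) *s j) ` block N) J"
  unfolding disjoint_family_on_def
proof (intro ballI impI)
  fix i j :: "int ^ 'd" assume "i \<noteq> j"
  show "act (int (2 * N + 1) *s i) ` block N \<inter> act (int (2 * N + 1) *s j) ` block N = {}"
  proof (rule ccontr)
    assume "\<not> ?thesis"
    then obtain x y where xy: "x \<in> block N" "y \<in> block N"
      "act (int (2 * N + 1) *s i) x = act (int (2 * N + 1) *s j) y"
      by blast
    then obtain g w g' w' where *: "g \<in> cube N" "w \<in> W" "g' \<in> cube N" "w' \<in> W"
      "act (int (2 * N + 1) *s i) (act g w) = act (int (2 * N + 1) *s j) (act g' w')"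
      by (auto simp: block_def)
    then have "int (2 * N + 1) *s i + g = int (2 * N + 1) *s j + g'"
      using act_eqD[OF *(2,4)] *(5) by (simp only: act_add)
    then show False
      using cube_tile_disjoint[OF *(1,3)] \<open>i \<noteq> j\<close> by blast
  qed
qed

text \<open>The translates of \<open>U\<close> to the tiles indexed by \<open>cube k\<close> have
  disjoint supports and the same dimension as \<open>U\<close>, so their dimensions add up inside
  \<open>S\<close>.\<close>

lemma dim_tiles_le:
  assumes U: "cfun.subspace U" "U \<subseteq> supported_on (block N)"
    and S: "cfun.subspace S" "S \<subseteq> supported_on A" "finite A"
    and sub: "\<And>j. j \<in> cube k \<Longrightarrow> translate act (int (2 * N + 1) *s j) ` U \<subseteq> S"
  shows "cube_vol CARD('d) k * cfun.dim U \<le> cfun.dim S"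
proof -
  let ?t = "\<lambda>j. translate act (int (2 * N + 1) *s j)"
  have "(\<Sum>j\<in>cube k. cfun.dim (?t j ` U)) \<le> cfun.dim S"
  proof (rule sum_dim_disjoint_supports_le[OF _ S _ sub _ tile_disjoint])
    fix j
    show "cfun.subspace (?t j ` U)"
      using U by (intro subspace_clinear_image clinear_on_translate)
    show "?t j ` U \<subseteq> supported_on (act (int (2 * N + 1) *s j) ` block N)"
      using U(2) translate_supported by blast
  qed auto
  also have "(\<Sum>j\<in>cube k. cfun.dim (?t j ` U)) = (\<Sum>j\<in>(cube k :: (int ^ 'd) set). cfun.dim U)"
    using U by (intro sum.cong dim_injective_image_supported[OF clinear_on_translate _ _ finite_block])
      (auto dest: translate_eq_0D)
  finally have "real (card (cube k :: (int ^ 'd) set) * cfun.dim U) \<le> real (cfun.dim S)"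
    by (simp only: of_nat_le_iff sum_constant of_nat_id)
  then show ?thesis by (simp add: card_cube)
qed

lemma tile_translation_in_cube: "j \<in> cube k \<Longrightarrow> int (2 * N + 1) *s j \<in> cube ((2 * N + 1) * k)"
proof -
  assume j: "j \<in> cube k"
  have "\<bar>int (2 * N + 1) * j $ i\<bar> \<le> int (2 * N + 1) * int k" for i
    unfolding abs_mult using j by (intro mult_mono) (auto simp: cube_def)
  then show ?thesis by (simp only: cube_def vector_smult_component of_nat_mult mem_Collect_eq) simp
qed

definition density :: "('x \<Rightarrow> complex) set \<Rightarrow> nat \<Rightarrow> real" where
  "density M N = cfun.dim (M \<inter> supported_on (block N)) / cube_vol CARD('d) N"

definition invariant_subspace :: "('x \<Rightarrow> complex) set \<Rightarrow> bool" where
  "invariant_subspace M \<longleftrightarrow> cfun.subspace M \<and> (\<forall>g. \<forall>f\<in>M. translate act g f \<in> M)"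

lemma density_le_card: "density M N \<le> card W"
proof -
  have "cfun.dim (M \<inter> supported_on (block N)) \<le> card (block N)"
    by (rule dim_le_card_supported) auto
  then have "real (cfun.dim (M \<inter> supported_on (block N))) \<le> card W * cube_vol CARD('d) N"
    unfolding card_block[symmetric] by simp
  then show ?thesis by (simp add: density_def pos_divide_le_eq)
qed

lemma bdd_density: "bdd_above (range (density M))"
  using density_le_card by (intro bdd_aboveI2)

text \<open>No term exceeds the supremum. Conversely, if some radius \<open>m\<close> has density
  above \<open>a\<close>, tiling large blocks by translates of the block of radius \<open>m\<close>
  keeps the density above \<open>a\<close> eventually.\<close>

lemma density_tendsto:
  assumes M: "invariant_subspace M"
  shows "density M \<longlonglongrightarrow> (SUP N. density M N)"
proof (rule order_tendstoI)
  fix a assume "a > (SUP N. density M N)"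
  then show "\<forall>\<^sub>F N in sequentially. density M N < a"
    using cSUP_upper[OF UNIV_I bdd_density] by (intro always_eventually) (meson le_less_trans)
next
  fix a assume "a < (SUP N. density M N)"
  then obtain m where m: "a < density M m"
    using less_cSUP_iff[OF _ bdd_density] by auto
  let ?f = "\<lambda>N. real (cfun.dim (M \<inter> supported_on (block N)))"
  \<comment> \<open>The margin is the gap \<open>density M m - a\<close>, so the left-hand side is
    just \<open>a\<close>. Invariance keeps the translates in \<open>M\<close>, so no room around
    the tiles is left and \<open>c\<close> is 0.\<close>
  have "\<forall>\<^sub>F N in sequentially. ?f m / cube_vol CARD('d) m - (density M m - a) < ?f N / cube_vol CARD('d) N"
  proof (rule tiling_density_lower_bound[where c = 0])
    show "mono ?f"
      by (intro monoI of_nat_mono dim_mono_supported[OF _ Int_lower2 finite_block] Int_mono order_refl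
          supported_block_mono)
    fix k
    show "cube_vol CARD('d) k * ?f m \<le> ?f ((2 * m + 1) * k + m + 0)"
    proof (rule dim_tiles_le)
      fix j :: "int ^ 'd" assume j: "j \<in> cube k"
      show "translate act (int (2 * m + 1) *s j) ` (M \<inter> supported_on (block m))
        \<subseteq> M \<inter> supported_on (block ((2 * m + 1) * k + m + 0))"
        using M translate_supported_block[OF tile_translation_in_cube[OF j]]
        by (auto simp: invariant_subspace_def)
    qed (use M in \<open>auto simp: invariant_subspace_def intro!: cfun.subspace_inter\<close>)
  qed (use m in auto)
  then show "\<forall>\<^sub>F N in sequentially. a < density M N"
    by (simp add: density_def)
qed

end

section \<open>Equivariant maps between spaces of finitely supported functions\<close>

locale equivariant_map =
  X: free_cofinite_action actX WX + Y: free_cofinite_action actY WY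
  for actX :: "int ^ 'd::finite \<Rightarrow> 'x \<Rightarrow> 'x" and WX
    and actY :: "int ^ 'd \<Rightarrow> 'y \<Rightarrow> 'y" and WY +
  fixes f :: "('x \<Rightarrow> complex) \<Rightarrow> 'y \<Rightarrow> complex"
  assumes linear: "clinear_on X.finsupp f"
    and maps_to: "u \<in> X.finsupp \<Longrightarrow> f u \<in> Y.finsupp"
    and equivariant: "u \<in> X.finsupp \<Longrightarrow> f (translate actX g u) = translate actY g (f u)"
begin

abbreviation kern where "kern \<equiv> kernel_on X.finsupp f"
abbreviation img where "img \<equiv> f ` X.finsupp"

lemma invariant_kern: "X.invariant_subspace kern"
  unfolding X.invariant_subspace_def
proof (intro conjI allI ballI)
  fix g u assume "u \<in> kern"
  moreover have "translate actY g 0 = 0" by (simp add: translate_def fun_eq_iff)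
  ultimately show "translate actX g u \<in> kern"
    using equivariant[of u g] X.translate_finsupp by (auto simp: kernel_on_def)
qed (intro subspace_clinear_kernel linear X.subspace_finsupp)

lemma invariant_img: "Y.invariant_subspace img"
  unfolding Y.invariant_subspace_def
proof (intro conjI allI ballI)
  fix g v assume "v \<in> img"
  then obtain u where "u \<in> X.finsupp" "v = f u" by blast
  then show "translate actY g v \<in> img"
    using equivariant[of u g] X.translate_finsupp by (metis image_eqI)
qed (intro subspace_clinear_image linear X.subspace_finsupp)

lemma linear_supported: "clinear_on (supported_on (X.block N)) f"
  using clinear_on_subset[OF linear X.supported_block_subset_finsupp] .

text \<open>The images of the finitely many functions \<open>delta w\<close> with \<open>w\<close>
  in \<open>WX\<close> fit into one block of radius \<open>c\<close>. By equivariance and linearity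
  the support then grows by at most \<open>c\<close> everywhere.\<close>

lemma finite_propagation:
  "\<exists>c. \<forall>N. f ` supported_on (X.block N) \<subseteq> supported_on (Y.block (N + c))"
proof -
  have W0: "w \<in> X.block 0" if "w \<in> WX" for w
    using X.block_memI[OF cube_zero that, of 0] by (simp add: X.act_zero)
  have dW: "delta w \<in> X.finsupp" if "w \<in> WX" for w
    using W0[OF that] X.supported_block_subset_finsupp[of 0] by (force simp: supported_on_def delta_def)
  obtain c where c: "\<forall>w\<in>WX. f (delta w) \<in> supported_on (Y.block c)"
    using Y.supported_block_common[OF X.finite_W, of "\<lambda>w. f (delta w)"] dW maps_to by blast
  have "f u \<in> supported_on (Y.block (N + c))" if u: "u \<in> supported_on (X.block N)" for u N
  proof -
    have deltas: "delta x \<in> supported_on (X.block N)" if "x \<in> X.block N" for x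
      using that by (auto simp: supported_on_def delta_def)
    have "f u = f (\<Sum>x\<in>X.block N. pointwise_scale (u x) (delta x))"
      using supported_on_expand[OF X.finite_block u] by simp
    also have "\<dots> = (\<Sum>x\<in>X.block N. f (pointwise_scale (u x) (delta x)))"
      by (intro clinear_on_sum[OF linear_supported[of N] subspace_supported_on]
          cfun.subspace_scale[OF subspace_supported_on] deltas)
    also have "\<dots> = (\<Sum>x\<in>X.block N. pointwise_scale (u x) (f (delta x)))"
      by (intro sum.cong refl clinear_onD(2)[OF linear_supported[of N]] deltas)
    also have "\<dots> \<in> supported_on (Y.block (N + c))"
    proof (intro cfun.subspace_sum cfun.subspace_scale subspace_supported_on)
      fix x assume "x \<in> X.block N"
      then obtain g w where gw: "g \<in> cube N" "w \<in> WX" "x = actX g w"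
        by (auto simp: X.block_def)
      then have "f (delta x) = translate actY g (f (delta w))"
        using equivariant[OF dW] X.translate_delta by metis
      then show "f (delta x) \<in> supported_on (Y.block (N + c))"
        using Y.translate_supported_block gw c by metis
    qed
    finally show ?thesis .
  qed
  then show ?thesis by blast
qed

text \<open>The image of a block and the part of \<open>img\<close> over that block differ: images
  spread by a bounded radius, and preimages may have larger support. From above, the spreading costs
  a factor tending to 1; from below, tiling with fixed preimages shows that the loss disappears in
  the limit.\<close>

lemma image_density_tendsto:
  "(\<lambda>N. cfun.dim (f ` supported_on (X.block N)) / cube_vol CARD('d) N) \<longlonglongrightarrow> (SUP N. Y.density img N)"
    (is "?b \<longlonglongrightarrow> ?L")
proof (rule order_tendstoI)
  obtain c where c: "\<And>N. f ` supported_on (X.block N) \<subseteq> supported_on (Y.block (N + c))"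
    using finite_propagation by blast
  have le: "?b N \<le> Y.density img (N + c) * (cube_vol CARD('d) (N + c) / cube_vol CARD('d) N)" for N
  proof -
    have "cfun.dim (f ` supported_on (X.block N)) \<le> cfun.dim (img \<inter> supported_on (Y.block (N + c)))"
      using c X.supported_block_subset_finsupp
      by (intro dim_mono_supported[OF _ Int_lower2 Y.finite_block] Int_greatest image_mono)
    then show ?thesis
      by (simp add: Y.density_def less_imp_neq[OF cube_vol_pos, symmetric] divide_right_mono less_imp_le)
  qed
  have "(\<lambda>N. Y.density img (N + c) * (cube_vol CARD('d) (N + c) / cube_vol CARD('d) N)) \<longlonglongrightarrow> ?L * 1"
    by (intro tendsto_mult cube_vol_shift LIMSEQ_ignore_initial_segment Y.density_tendsto invariant_img)
  then have lim: "(\<lambda>N. Y.density img (N + c) * (cube_vol CARD('d) (N + c) / cube_vol CARD('d) N)) \<longlonglongrightarrow> ?L"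
    by simp
  fix a assume "a > ?L"
  from order_tendstoD(2)[OF lim this] show "\<forall>\<^sub>F N in sequentially. ?b N < a"
    by eventually_elim (rule le_less_trans[OF le])
next
  fix a assume "a < ?L"
  then obtain m where m: "a < Y.density img m"
    using less_cSUP_iff[OF _ Y.bdd_density] by auto
  let ?U = "img \<inter> supported_on (Y.block m)"
  let ?f = "\<lambda>N. real (cfun.dim (f ` supported_on (X.block N)))"
  have im: "cfun.subspace (f ` supported_on (X.block N))" for N
    by (intro subspace_clinear_image linear_supported subspace_supported_on)
  \<comment> \<open>Here finite propagation serves to bound the supports in the image of a block, so
    that its dimension is finite.\<close>
  obtain c where c: "\<And>N. f ` supported_on (X.block N) \<subseteq> supported_on (Y.block (N + c))"
    using finite_propagation by blast
  obtain b where b: "b \<subseteq> ?U" "cfun.independent b" "?U \<subseteq> cfun.span b" "card b = cfun.dim ?U"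
    by (rule cfun.basis_exists)
  have "b \<subseteq> cfun.span (delta ` Y.block m)"
    using b(1) supported_on_span[OF Y.finite_block] by blast
  then have "finite b"
    using cfun.independent_span_bound[of "delta ` Y.block m" b] b(2) by simp
  \<comment> \<open>A basis of the part of \<open>img\<close> over the fixed block of radius
    \<open>m\<close> is finite, so preimages of all its members are supported in a common block of
    radius \<open>l\<close>.\<close>
  have "\<forall>y\<in>b. \<exists>u. u \<in> X.finsupp \<and> f u = y"
    using b(1) by auto
  then obtain p where p: "\<forall>y\<in>b. p y \<in> X.finsupp \<and> f (p y) = y"
    unfolding bchoice_iff by blast
  then obtain l where l: "\<forall>y\<in>b. p y \<in> supported_on (X.block l)"
    using X.supported_block_common[OF \<open>finite b\<close>] by blast
  have "b \<subseteq> f ` supported_on (X.block l)"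
    using l p by (force simp: image_iff)
  then have Ul: "?U \<subseteq> f ` supported_on (X.block l)"
    using b(3) cfun.span_minimal[OF _ im] by blast
  have "\<forall>\<^sub>F N in sequentially. cfun.dim ?U / cube_vol CARD('d) m - (Y.density img m - a) < ?f N / cube_vol CARD('d) N"
  proof (rule tiling_density_lower_bound[where c = l])
    show "mono ?f"
    proof (rule monoI)
      fix M N :: nat assume "M \<le> N"
      then show "?f M \<le> ?f N"
        using X.supported_block_mono[of M N] c[of N]
        by (intro of_nat_mono dim_mono_supported[OF _ _ Y.finite_block] image_mono)
    qed
    fix k
    show "cube_vol CARD('d) k * cfun.dim ?U \<le> ?f ((2 * m + 1) * k + m + l)"
    proof (rule Y.dim_tiles_le[OF _ _ im c Y.finite_block])
      show "cfun.subspace ?U"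
        using invariant_img by (auto simp: Y.invariant_subspace_def intro!: cfun.subspace_inter)
      fix j :: "int ^ 'd" assume j: "j \<in> cube k"
      let ?g = "int (2 * m + 1) *s j"
      have "translate actY ?g y \<in> f ` supported_on (X.block ((2 * m + 1) * k + m + l))" if "y \<in> ?U" for y
      proof -
        have "y \<in> f ` supported_on (X.block l)" using Ul that by (rule subsetD)
        then obtain u where u: "u \<in> supported_on (X.block l)" "y = f u" by (rule imageE)
        have "translate actX ?g u \<in> supported_on (X.block ((2 * m + 1) * k + l))"
          by (rule X.translate_supported_block[OF X.tile_translation_in_cube[OF j] u(1)])
        \<comment> \<open>The translated preimage already lives over radius
          \<open>(2 * m + 1) * k + l\<close>; enlarging it by \<open>m\<close> gives the radius in
          the tiling bound.\<close>
        then have "translate actX ?g u \<in> supported_on (X.block ((2 * m + 1) * k + m + l))"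
          using X.supported_block_mono[of "(2 * m + 1) * k + l" "(2 * m + 1) * k + m + l"] by auto
        moreover have "translate actY ?g y = f (translate actX ?g u)"
          using equivariant[of u ?g] u X.supported_block_subset_finsupp[of l] by (simp only: subsetD)
        ultimately show ?thesis by simp
      qed
      then show "translate actY ?g ` ?U \<subseteq> f ` supported_on (X.block ((2 * m + 1) * k + m + l))"
        by blast
    qed auto
  qed (use m in auto)
  then show "\<forall>\<^sub>F N in sequentially. a < ?b N"
    by (simp add: Y.density_def)
qed

text \<open>Over each block rank and nullity hold exactly, the whole space there having dimension
  \<open>card WX\<close> times the number of points of the cube. The rank is that of the image of a
  block, and the preceding limit converts it into the density of \<open>img\<close>.\<close>

lemma density_rank_nullity: "(SUP N. X.density kern N) + (SUP N. Y.density img N) = card WX"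
proof -
  have "X.density kern N + cfun.dim (f ` supported_on (X.block N)) / cube_vol CARD('d) N = card WX" for N
  proof -
    have "kern \<inter> supported_on (X.block N) = kernel_on (supported_on (X.block N)) f"
      using X.supported_block_subset_finsupp by (auto simp: kernel_on_def)
    then have "cfun.dim (kern \<inter> supported_on (X.block N)) + cfun.dim (f ` supported_on (X.block N))
        = card (X.block N)"
      using dim_image_kernel_supported[OF linear_supported subspace_supported_on order_refl X.finite_block]
      by (simp add: dim_supported_on)
    then have "real (cfun.dim (kern \<inter> supported_on (X.block N))) + cfun.dim (f ` supported_on (X.block N))
        = card WX * cube_vol CARD('d) N"
      unfolding X.card_block[symmetric] by linarith
    then show ?thesis
      by (simp add: X.density_def add_divide_distrib[symmetric] less_imp_neq[OF cube_vol_pos, symmetric])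
  qed
  moreover have "(\<lambda>N. X.density kern N + cfun.dim (f ` supported_on (X.block N)) / cube_vol CARD('d) N)
    \<longlonglongrightarrow> (SUP N. X.density kern N) + (SUP N. Y.density img N)"
    by (intro tendsto_add X.density_tendsto invariant_kern image_density_tendsto)
  ultimately have "(\<lambda>N::nat. real (card WX)) \<longlonglongrightarrow> (SUP N. X.density kern N) + (SUP N. Y.density img N)"
    by simp
  from LIMSEQ_unique[OF tendsto_const this] show ?thesis by simp
qed

end

subsection \<open>Orthogonal projections and traces\<close>

definition l2_sqnorm :: "('v \<Rightarrow> complex) \<Rightarrow> real" where
  "l2_sqnorm f = (\<Sum>\<^sub>\<infinity>v. (cmod (f v))\<^sup>2)"

lemma l2_0 [simp]: "0 \<in> l2"
  by (simp add: l2_def)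

lemma l2_add:
  assumes "f \<in> l2" "g \<in> l2"
  shows "f + g \<in> l2"
proof -
  have "(\<lambda>v. 2 * (cmod (f v))\<^sup>2 + 2 * (cmod (g v))\<^sup>2) summable_on UNIV"
    using assms unfolding l2_def by (intro summable_on_add summable_on_cmult_right) auto
  moreover have "(cmod (f v + g v))\<^sup>2 \<le> 2 * (cmod (f v))\<^sup>2 + 2 * (cmod (g v))\<^sup>2" for v
  proof -
    have "(cmod (f v + g v))\<^sup>2 \<le> (cmod (f v) + cmod (g v))\<^sup>2"
      by (intro power_mono norm_triangle_ineq) auto
    also have "\<dots> \<le> 2 * (cmod (f v))\<^sup>2 + 2 * (cmod (g v))\<^sup>2"
      using sum_squares_bound[of "cmod (f v)" "cmod (g v)"] by (simp add: power2_sum)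
    finally show ?thesis .
  qed
  ultimately have "(\<lambda>v. (cmod (f v + g v))\<^sup>2) summable_on UNIV"
    by (rule summable_on_comparison_test) auto
  then show ?thesis by (simp add: l2_def)
qed

lemma l2_scale:
  assumes "f \<in> l2"
  shows "pointwise_scale c f \<in> l2"
  using assms unfolding l2_def
  by (auto simp: pointwise_scale_def norm_mult power_mult_distrib intro!: summable_on_cmult_right)

lemma subspace_l2 [simp]: "cfun.subspace l2"
  by (rule cfun.subspaceI[OF l2_0 l2_add l2_scale])

lemmas l2_diff = cfun.subspace_diff[OF subspace_l2]
lemmas l2_sum = cfun.subspace_sum[OF subspace_l2]

lemma supported_on_subset_l2:
  assumes "finite A"
  shows "supported_on A \<subseteq> l2"
proof
  fix f :: "'a \<Rightarrow> complex" assume "f \<in> supported_on A"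
  then have "(\<lambda>v. (cmod (f v))\<^sup>2) summable_on UNIV \<longleftrightarrow> (\<lambda>v. (cmod (f v))\<^sup>2) summable_on A"
    by (intro summable_on_cong_neutral) (auto simp: supported_on_def)
  then show "f \<in> l2" using assms by (simp add: l2_def)
qed

lemma delta_l2 [simp]: "delta v \<in> l2"
  using supported_on_subset_l2[of "{v}"] by (auto simp: supported_on_def delta_def)

lemma l2_inner_summable:
  assumes "f \<in> l2" "g \<in> l2"
  shows "(\<lambda>v. cnj (f v) * g v) summable_on UNIV"
proof (rule abs_summable_summable)
  have "(\<lambda>v. (cmod (f v))\<^sup>2 + (cmod (g v))\<^sup>2) summable_on UNIV"
    using assms unfolding l2_def by (intro summable_on_add) auto
  then show "(\<lambda>v. norm (cnj (f v) * g v)) summable_on UNIV"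
  proof (rule summable_on_comparison_test)
    fix v
    have "2 * (cmod (f v) * cmod (g v)) \<le> (cmod (f v))\<^sup>2 + (cmod (g v))\<^sup>2"
      using sum_squares_bound[of "cmod (f v)" "cmod (g v)"] by simp
    moreover have "0 \<le> cmod (f v) * cmod (g v)" by simp
    ultimately show "norm (cnj (f v) * g v) \<le> (cmod (f v))\<^sup>2 + (cmod (g v))\<^sup>2"
      unfolding norm_mult complex_mod_cnj by linarith
  qed auto
qed

lemma l2_inner_add_right:
  "f \<in> l2 \<Longrightarrow> g \<in> l2 \<Longrightarrow> h \<in> l2 \<Longrightarrow> l2_inner f (g + h) = l2_inner f g + l2_inner f h"
  unfolding l2_inner_def by (simp add: distrib_left infsum_add l2_inner_summable)

lemma l2_inner_scale_right:
  "l2_inner f (pointwise_scale c g) = c * l2_inner f g"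
proof -
  have "l2_inner f (pointwise_scale c g) = (\<Sum>\<^sub>\<infinity>v. c * (cnj (f v) * g v))"
    unfolding l2_inner_def pointwise_scale_def by (simp add: mult_ac)
  then show ?thesis by (simp add: l2_inner_def infsum_cmult_right')
qed

lemma l2_inner_commute: "l2_inner g f = cnj (l2_inner f g)"
  unfolding l2_inner_def by (simp add: mult.commute flip: infsum_cnj)

lemma l2_inner_0 [simp]: "l2_inner f 0 = 0" "l2_inner 0 f = 0"
  by (simp_all add: l2_inner_def)

lemma l2_inner_diff_right:
  assumes "f \<in> l2" "g \<in> l2" "h \<in> l2"
  shows "l2_inner f (g - h) = l2_inner f g - l2_inner f h"
proof -
  have "l2_inner f (g - h + h) = l2_inner f (g - h) + l2_inner f h"
    by (intro l2_inner_add_right l2_diff assms)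
  then show ?thesis by simp
qed

lemma l2_inner_diff_left:
  assumes "f \<in> l2" "g \<in> l2" "h \<in> l2"
  shows "l2_inner (g - h) f = l2_inner g f - l2_inner h f"
  unfolding l2_inner_commute[of _ f] l2_inner_diff_right[OF assms] by simp

lemma l2_inner_scale_left:
  "l2_inner (pointwise_scale c g) f = cnj c * l2_inner g f"
  unfolding l2_inner_commute[of _ f] l2_inner_scale_right by simp

lemma l2_inner_sum_right:
  assumes "f \<in> l2" "\<And>i. i \<in> I \<Longrightarrow> g i \<in> l2"
  shows "l2_inner f (\<Sum>i\<in>I. g i) = (\<Sum>i\<in>I. l2_inner f (g i))"
  using assms(2)
proof (induction I rule: infinite_finite_induct)
  case (insert i I)
  have "l2_inner f (g i + (\<Sum>i\<in>I. g i)) = l2_inner f (g i) + l2_inner f (\<Sum>i\<in>I. g i)"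
    using insert.prems by (intro l2_inner_add_right assms(1) l2_sum) auto
  then show ?case
    using insert.IH insert.prems unfolding sum.insert[OF insert.hyps] by (metis insertCI)
qed auto

lemma l2_inner_sum_left:
  assumes "f \<in> l2" "\<And>i. i \<in> I \<Longrightarrow> g i \<in> l2"
  shows "l2_inner (\<Sum>i\<in>I. g i) f = (\<Sum>i\<in>I. l2_inner (g i) f)"
  using l2_inner_sum_right[of f I g] assms unfolding l2_inner_commute[of _ f] by simp

lemma l2_inner_self: "l2_inner f f = complex_of_real (l2_sqnorm f)"
proof -
  have "l2_inner f f = (\<Sum>\<^sub>\<infinity>v. complex_of_real ((cmod (f v))\<^sup>2))"
    unfolding l2_inner_def by (intro infsum_cong) (metis complex_norm_square mult.commute)
  then show ?thesis
    unfolding l2_sqnorm_def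
    by (simp only: infsum_bounded_linear_strong[OF summable_on_bounded_linear_iff
          [OF bounded_linear_of_real bounded_linear_Re Re_complex_of_real] bounded_linear_of_real])
qed

lemma l2_sqnorm_nonneg: "l2_sqnorm f \<ge> 0"
  unfolding l2_sqnorm_def by (intro infsum_nonneg) auto

lemma finite_sum_le_l2_sqnorm:
  assumes "f \<in> l2" "finite F"
  shows "(\<Sum>v\<in>F. (cmod (f v))\<^sup>2) \<le> l2_sqnorm f"
  unfolding l2_sqnorm_def using assms by (intro finite_sum_le_infsum) (auto simp: l2_def)

lemma l2_sqnorm_eq_0D:
  assumes "f \<in> l2" "l2_sqnorm f = 0"
  shows "f = 0"
proof
  fix v
  show "f v = 0 v" using finite_sum_le_l2_sqnorm[OF assms(1), of "{v}"] assms(2) by simp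
qed

lemma l2_sqnorm_diff:
  assumes "f \<in> l2" "g \<in> l2"
  shows "l2_sqnorm (f - g) = l2_sqnorm f - 2 * Re (l2_inner f g) + l2_sqnorm g"
proof -
  have "l2_inner (f - g) (f - g) = l2_inner f f - l2_inner f g - (l2_inner g f - l2_inner g g)"
    using assms by (simp add: l2_inner_diff_left l2_inner_diff_right l2_diff)
  from arg_cong[OF this, of Re] show ?thesis
    by (simp add: l2_inner_self l2_inner_commute[of g f])
qed

lemma l2_inner_supported:
  assumes "finite A" "f \<in> supported_on A"
  shows "l2_inner f g = (\<Sum>v\<in>A. cnj (f v) * g v)"
proof -
  have "l2_inner f g = (\<Sum>\<^sub>\<infinity>v\<in>A. cnj (f v) * g v)"
    unfolding l2_inner_def using assms(2) by (intro infsum_cong_neutral) (auto simp: supported_on_def)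
  then show ?thesis using assms(1) by simp
qed

lemma l2_inner_delta: "l2_inner (delta v) f = f v"
proof -
  have "l2_inner (delta v) f = (\<Sum>w\<in>{v}. cnj (delta v w) * f w)"
    by (intro l2_inner_supported) (auto simp: supported_on_def delta_def)
  then show ?thesis by (simp add: delta_def)
qed

lemma l2_inner_delta_right: "l2_inner f (delta v) = cnj (f v)"
  by (simp add: l2_inner_commute[of f] l2_inner_delta)

lemma l2_sqnorm_supported:
  assumes "finite A" "f \<in> supported_on A"
  shows "l2_sqnorm f = (\<Sum>v\<in>A. (cmod (f v))\<^sup>2)"
proof -
  have "l2_sqnorm f = (\<Sum>\<^sub>\<infinity>v\<in>A. (cmod (f v))\<^sup>2)"
    unfolding l2_sqnorm_def using assms(2) by (intro infsum_cong_neutral) (auto simp: supported_on_def)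
  then show ?thesis using assms(1) by simp
qed

text \<open>Closedness under pointwise limits is stronger than closedness in norm, since norm
  convergence implies pointwise convergence. It suits conditions that involve finitely many
  coordinates at a time, as the eigenvalue equation at a vertex does.\<close>

definition pointwise_closed :: "('v \<Rightarrow> complex) set \<Rightarrow> bool" where
  "pointwise_closed H \<longleftrightarrow>
     (\<forall>s h. (\<forall>n. s n \<in> H) \<and> h \<in> l2 \<and> (\<forall>v. (\<lambda>n. s n v) \<longlonglongrightarrow> h v) \<longrightarrow> h \<in> H)"

text \<open>The form with the midpoint suits a minimising sequence: the midpoint of two members of a
  subspace is again a member, so its distance is bounded below.\<close>

lemma l2_parallelogram:
  assumes "f \<in> l2" "g \<in> l2"
  shows "l2_sqnorm (f - g) = 2 * l2_sqnorm f + 2 * l2_sqnorm g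
    - 4 * l2_sqnorm (pointwise_scale (1/2) (f + g))"
proof -
  have s: "(\<lambda>v. (cmod (f v))\<^sup>2) summable_on UNIV" "(\<lambda>v. (cmod (g v))\<^sup>2) summable_on UNIV"
    "(\<lambda>v. (cmod (pointwise_scale (1/2) (f + g) v))\<^sup>2) summable_on UNIV"
    "(\<lambda>v. (cmod ((f - g) v))\<^sup>2) summable_on UNIV"
    using assms l2_scale[OF l2_add[OF assms]] l2_diff[OF assms] by (simp_all only: l2_def mem_Collect_eq)
  have p: "(cmod ((f - g) v))\<^sup>2 + 4 * (cmod (pointwise_scale (1/2) (f + g) v))\<^sup>2
      = 2 * (cmod (f v))\<^sup>2 + 2 * (cmod (g v))\<^sup>2" for v
    by (simp add: pointwise_scale_def norm_mult power_mult_distrib power_divide)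
      (simp add: cmod_power2 power2_diff power2_sum)
  have "l2_sqnorm (f - g) + 4 * l2_sqnorm (pointwise_scale (1/2) (f + g))
      = (\<Sum>\<^sub>\<infinity>v. (cmod ((f - g) v))\<^sup>2 + 4 * (cmod (pointwise_scale (1/2) (f + g) v))\<^sup>2)"
    unfolding l2_sqnorm_def infsum_cmult_right'[symmetric]
    by (intro infsum_add[symmetric] summable_on_cmult_right s)
  also have "\<dots> = 2 * l2_sqnorm f + 2 * l2_sqnorm g"
    unfolding p l2_sqnorm_def infsum_cmult_right'[symmetric]
    by (intro infsum_add summable_on_cmult_right s)
  finally show ?thesis by simp
qed

text \<open>The parallelogram law makes a minimising sequence Cauchy in each coordinate. Its
  pointwise limit is shown to be a minimiser by bounding finite partial sums.\<close>

lemma l2_closest_point: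
  assumes H: "cfun.subspace H" "H \<subseteq> l2" "pointwise_closed H" and f: "f \<in> l2"
  shows "\<exists>g\<in>H. \<forall>h\<in>H. l2_sqnorm (f - g) \<le> l2_sqnorm (f - h)"
proof -
  define m where "m = (INF h\<in>H. l2_sqnorm (f - h))"
  have ne: "H \<noteq> {}" using cfun.subspace_0[OF H(1)] by auto
  have bdd: "bdd_below ((\<lambda>h. l2_sqnorm (f - h)) ` H)"
    using l2_sqnorm_nonneg by (intro bdd_belowI2)
  have m: "m \<le> l2_sqnorm (f - h)" if "h \<in> H" for h
    unfolding m_def by (rule cINF_lower[OF bdd that])
  have "\<forall>n. \<exists>h. h \<in> H \<and> l2_sqnorm (f - h) < m + 1 / real (Suc n)"
  proof
    fix n
    have "m < m + 1 / real (Suc n)" by simp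
    then show "\<exists>h. h \<in> H \<and> l2_sqnorm (f - h) < m + 1 / real (Suc n)"
      unfolding m_def cINF_less_iff[OF ne bdd] by blast
  qed
  then obtain s where s: "\<forall>n. s n \<in> H \<and> l2_sqnorm (f - s n) < m + 1 / real (Suc n)"
    unfolding choice_iff by blast
  have sl2: "f - s n \<in> l2" for n using s H(2) f by (intro l2_diff) auto
  have sq: "(cmod (s n v - s k v))\<^sup>2 \<le> 2 / real (Suc n) + 2 / real (Suc k)" for n k v
  proof -
    let ?a = "f - s n" and ?b = "f - s k" and ?c = "pointwise_scale (1/2) (s n + s k)"
    \<comment> \<open>The midpoint of \<open>s n\<close> and \<open>s k\<close> lies in
      \<open>H\<close>, so its squared distance from \<open>f\<close> is at least \<open>m\<close>;
      this cancels the \<open>4 * m\<close> coming from the two sequence members.\<close>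
    have "?c \<in> H" using s by (intro cfun.subspace_scale[OF H(1)] cfun.subspace_add[OF H(1)]) auto
    then have "m \<le> l2_sqnorm (f - ?c)" by (rule m)
    moreover have "f - ?c = pointwise_scale (1/2) (?a + ?b)"
      by (simp add: fun_eq_iff pointwise_scale_def field_simps)
    moreover have "(cmod (s n v - s k v))\<^sup>2 = (\<Sum>v\<in>{v}. (cmod ((?a - ?b) v))\<^sup>2)"
      by (simp add: norm_minus_commute)
    moreover have "(\<Sum>v\<in>{v}. (cmod ((?a - ?b) v))\<^sup>2) \<le> l2_sqnorm (?a - ?b)"
      by (intro finite_sum_le_l2_sqnorm l2_diff sl2) auto
    moreover have "l2_sqnorm ?a < m + 1 / real (Suc n)" "l2_sqnorm ?b < m + 1 / real (Suc k)"
      using s by auto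
    ultimately show ?thesis
      using l2_parallelogram[OF sl2[of n] sl2[of k]] by simp
  qed
  have "Cauchy (\<lambda>n. s n v)" for v
  proof (rule CauchyI)
    fix e :: real assume "0 < e"
    obtain M where M: "inverse (real (Suc M)) < e\<^sup>2 / 4"
      using reals_Archimedean[of "e\<^sup>2 / 4"] \<open>0 < e\<close> by auto
    have "norm (s n v - s k v) < e" if "n \<ge> M" "k \<ge> M" for n k
    proof -
      have "2 / real (Suc n) \<le> 2 / real (Suc M)" "2 / real (Suc k) \<le> 2 / real (Suc M)"
        using that by (auto intro!: divide_left_mono)
      then have "(cmod (s n v - s k v))\<^sup>2 < e\<^sup>2"
        using sq[of n v k] M by (simp add: inverse_eq_divide)
      then show ?thesis using \<open>0 < e\<close> power2_less_imp_less by fastforce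
    qed
    then show "\<exists>M. \<forall>m\<ge>M. \<forall>n\<ge>M. norm (s m v - s n v) < e" by blast
  qed
  then have "\<forall>v. \<exists>l. (\<lambda>n. s n v) \<longlonglongrightarrow> l"
    using Cauchy_convergent_iff convergent_def by blast
  then obtain g where g: "\<forall>v. (\<lambda>n. s n v) \<longlonglongrightarrow> g v"
    unfolding choice_iff by blast
  \<comment> \<open>A Fatou argument: partial sums over a finite set pass to the limit, so the bound
    \<open>m\<close> yields both summability for the limit and its minimality.\<close>
  have part: "(\<Sum>v\<in>F. (cmod ((f - g) v))\<^sup>2) \<le> m" if "finite F" for F
  proof (rule LIMSEQ_le)
    show "(\<lambda>n. \<Sum>v\<in>F. (cmod ((f - s n) v))\<^sup>2) \<longlonglongrightarrow> (\<Sum>v\<in>F. (cmod ((f - g) v))\<^sup>2)"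
      using g by (auto intro!: tendsto_intros)
    show "(\<lambda>n. m + 1 / real (Suc n)) \<longlonglongrightarrow> m"
      using tendsto_add[OF tendsto_const[of m] LIMSEQ_inverse_real_of_nat] by (simp add: inverse_eq_divide)
    show "\<exists>N. \<forall>n\<ge>N. (\<Sum>v\<in>F. (cmod ((f - s n) v))\<^sup>2) \<le> m + 1 / real (Suc n)"
      using finite_sum_le_l2_sqnorm[OF sl2 that] s by (meson less_imp_le order_trans)
  qed
  have summ: "(\<lambda>v. (cmod ((f - g) v))\<^sup>2) summable_on UNIV"
    using part by (intro nonneg_bdd_above_summable_on bdd_aboveI2[where M = m]) auto
  then have fg: "f - g \<in> l2" by (simp add: l2_def)
  have "f - (f - g) \<in> l2" by (intro l2_diff f fg)
  then have "g \<in> l2" by simp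
  then have "g \<in> H"
    using H(3) s g unfolding pointwise_closed_def by blast
  moreover have "l2_sqnorm (f - g) \<le> m"
    unfolding l2_sqnorm_def by (rule infsum_le_finite_sums[OF summ]) (use part in auto)
  ultimately show ?thesis using m order_trans by blast
qed

text \<open>At the closest point, moving along any \<open>h\<close> in \<open>H\<close> cannot
  reduce the distance; a suitable step length turns this into orthogonality.\<close>

lemma l2_orthogonal_projection_exists:
  assumes H: "cfun.subspace H" "H \<subseteq> l2" "pointwise_closed H" and f: "f \<in> l2"
  shows "\<exists>g\<in>H. \<forall>h\<in>H. l2_inner h (f - g) = 0"
proof -
  obtain g where g: "g \<in> H" "\<And>h. h \<in> H \<Longrightarrow> l2_sqnorm (f - g) \<le> l2_sqnorm (f - h)"
    using l2_closest_point[OF assms] by blast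
  have "l2_inner h (f - g) = 0" if h: "h \<in> H" for h
  proof (cases "l2_sqnorm h = 0")
    case True
    then have "h = 0" using h H(2) l2_sqnorm_eq_0D by blast
    then show ?thesis by simp
  next
    case False
    then have pos: "l2_sqnorm h > 0" using l2_sqnorm_nonneg[of h] by simp
    let ?u = "f - g" and ?a = "l2_inner h (f - g)"
    \<comment> \<open>This \<open>c\<close> minimises the distance from \<open>?u\<close> to
      multiples of \<open>h\<close>. Comparison with the multiple 0 gives
      \<open>2 * t \<le> t\<close> for \<open>t = (cmod ?a)\<^sup>2 / l2_sqnorm h\<close>, which
      forces \<open>?a\<close> to vanish.\<close>
    define c where "c = ?a / complex_of_real (l2_sqnorm h)"
    have hl2: "h \<in> l2" "?u \<in> l2" using h g(1) H(2) f by (auto intro: l2_diff)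
    have "l2_sqnorm ?u \<le> l2_sqnorm (f - (g + pointwise_scale c h))"
      using g(1) h by (intro g(2) cfun.subspace_add[OF H(1)] cfun.subspace_scale[OF H(1)])
    also have "f - (g + pointwise_scale c h) = ?u - pointwise_scale c h"
      by (simp add: fun_eq_iff)
    also have "l2_sqnorm (?u - pointwise_scale c h)
        = l2_sqnorm ?u - 2 * Re (c * cnj ?a) + (cmod c)\<^sup>2 * l2_sqnorm h"
    proof -
      have "complex_of_real (l2_sqnorm (pointwise_scale c h)) = complex_of_real ((cmod c)\<^sup>2 * l2_sqnorm h)"
        unfolding of_real_mult complex_norm_square l2_inner_self[symmetric]
          l2_inner_scale_left l2_inner_scale_right by simp
      then have "l2_sqnorm (pointwise_scale c h) = (cmod c)\<^sup>2 * l2_sqnorm h"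
        by (simp only: of_real_eq_iff)
      then show ?thesis
        using l2_sqnorm_diff[OF hl2(2) l2_scale[OF hl2(1)], of c]
        by (simp add: l2_inner_scale_right l2_inner_commute[of ?u h])
    qed
    finally have "2 * Re (c * cnj ?a) \<le> (cmod c)\<^sup>2 * l2_sqnorm h" by linarith
    moreover have "Re (c * cnj ?a) = (cmod ?a)\<^sup>2 / l2_sqnorm h"
    proof -
      have "c * cnj ?a = complex_of_real ((cmod ?a)\<^sup>2 / l2_sqnorm h)"
        unfolding of_real_divide complex_norm_square by (simp add: c_def)
      then show ?thesis by (simp only: Re_complex_of_real)
    qed
    moreover have "(cmod c)\<^sup>2 * l2_sqnorm h = (cmod ?a)\<^sup>2 / l2_sqnorm h"
      using pos by (simp add: c_def norm_divide power2_eq_square)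
    ultimately have "(cmod ?a)\<^sup>2 / l2_sqnorm h \<le> 0" by simp
    then show ?thesis using pos by (simp add: divide_le_0_iff)
  qed
  then show ?thesis using g(1) by blast
qed

text \<open>Two candidates differ by a member of \<open>H\<close> that is orthogonal to itself. This
  lets the definite description in \<open>orth_proj\<close> be evaluated from any witness.\<close>

lemma orth_proj_unique:
  assumes "cfun.subspace H" "H \<subseteq> l2" "f \<in> l2"
    and g: "g \<in> H" "\<forall>h\<in>H. l2_inner h (f - g) = 0"
  shows "orth_proj H f = g"
  unfolding orth_proj_def
proof (rule the_equality)
  fix g' assume g': "g' \<in> H \<and> (\<forall>h\<in>H. l2_inner h (f - g') = 0)"
  have gg: "g - g' \<in> H" using g g' by (intro cfun.subspace_diff[OF assms(1)]) auto
  have in_l2: "g - g' \<in> l2" "f - g \<in> l2" "f - g' \<in> l2"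
    using gg g g' assms by (auto intro: l2_diff)
  have "g - g' = (f - g') - (f - g)" by simp
  then have "l2_inner (g - g') (g - g') = l2_inner (g - g') (f - g') - l2_inner (g - g') (f - g)"
    using l2_inner_diff_right[OF in_l2(1,3,2)] by simp
  also have "\<dots> = 0" using gg g g' by simp
  finally have "l2_sqnorm (g - g') = 0" by (simp add: l2_inner_self)
  then have "g - g' = 0" using l2_sqnorm_eq_0D[OF in_l2(1)] by blast
  then show "g' = g" by (simp only: right_minus_eq)
qed (use g in blast)

section \<open>Orthonormal families and bases\<close>

definition orthonormal :: "('v \<Rightarrow> complex) set \<Rightarrow> bool" where
  "orthonormal B \<longleftrightarrow> (\<forall>e\<in>B. \<forall>e'\<in>B. l2_inner e e' = (if e = e' then 1 else 0))"

lemma orthonormal_inner_sum: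
  assumes "orthonormal B" "finite B" "B \<subseteq> l2" "e \<in> B"
  shows "l2_inner e (\<Sum>b\<in>B. pointwise_scale (c b) b) = c e"
proof -
  have "l2_inner e (\<Sum>b\<in>B. pointwise_scale (c b) b) = (\<Sum>b\<in>B. l2_inner e (pointwise_scale (c b) b))"
    using assms by (intro l2_inner_sum_right l2_scale) auto
  also have "\<dots> = (\<Sum>b\<in>B. if e = b then c b else 0)"
    using assms by (intro sum.cong) (auto simp: l2_inner_scale_right orthonormal_def)
  finally show ?thesis using assms by simp
qed

lemma orthonormal_independent:
  assumes "orthonormal B" "finite B" "B \<subseteq> l2"
  shows "cfun.independent B"
proof (rule cfun.independent_if_scalars_zero)
  fix c b assume "(\<Sum>x\<in>B. pointwise_scale (c x) x) = 0" "b \<in> B"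
  then show "c b = 0" using orthonormal_inner_sum[OF assms, of b c] by simp
qed (rule assms)

text \<open>The expansion \<open>?s\<close> has squared norm and inner product with \<open>f\<close>
  both equal to the sum on the left; expanding the nonnegative \<open>l2_sqnorm (f - ?s)\<close>
  gives the bound.\<close>

lemma orthonormal_bessel:
  assumes B: "orthonormal B" "finite B" "B \<subseteq> l2" and f: "f \<in> l2"
  shows "(\<Sum>e\<in>B. (cmod (l2_inner e f))\<^sup>2) \<le> l2_sqnorm f"
proof -
  let ?s = "\<Sum>b\<in>B. pointwise_scale (l2_inner b f) b"
  have s: "?s \<in> l2" using B by (intro l2_sum l2_scale) auto
  have left: "l2_inner ?s g = (\<Sum>e\<in>B. cnj (l2_inner e f) * l2_inner e g)" if "g \<in> l2" for g
  proof -
    have "l2_inner ?s g = (\<Sum>e\<in>B. l2_inner (pointwise_scale (l2_inner e f) e) g)"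
      using B by (intro l2_inner_sum_left l2_scale that) auto
    then show ?thesis by (simp add: l2_inner_scale_left)
  qed
  have sf: "l2_inner ?s f = complex_of_real (\<Sum>e\<in>B. (cmod (l2_inner e f))\<^sup>2)"
    unfolding left[OF f] of_real_sum by (intro sum.cong refl) (metis complex_norm_square mult.commute)
  have "l2_inner ?s ?s = l2_inner ?s f"
    unfolding left[OF f] left[OF s] by (intro sum.cong refl) (simp add: orthonormal_inner_sum[OF B])
  then have "l2_sqnorm ?s = (\<Sum>e\<in>B. (cmod (l2_inner e f))\<^sup>2)"
    unfolding sf l2_inner_self by (simp only: of_real_eq_iff)
  moreover have "Re (l2_inner f ?s) = (\<Sum>e\<in>B. (cmod (l2_inner e f))\<^sup>2)"
    unfolding l2_inner_commute[of f] sf by simp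
  ultimately show ?thesis
    using l2_sqnorm_diff[OF f s] l2_sqnorm_nonneg[of "f - ?s"] by simp
qed

text \<open>One Gram-Schmidt step: subtract from \<open>u\<close> its expansion in \<open>B\<close>
  and normalise the remainder.\<close>

lemma orthonormal_extend:
  assumes B: "orthonormal B" "finite B" "B \<subseteq> U" and U: "cfun.subspace U" "U \<subseteq> l2"
    and u: "u \<in> U" "u \<notin> cfun.span B"
  shows "\<exists>e\<in>U - B. orthonormal (insert e B)"
proof -
  let ?s = "\<Sum>b\<in>B. pointwise_scale (l2_inner b u) b"
  let ?w = "u - ?s"
  have Bl2: "B \<subseteq> l2" using B U by auto
  have sU: "?s \<in> U"
    using B by (intro cfun.subspace_sum[OF U(1)] cfun.subspace_scale[OF U(1)]) auto
  have w: "?w \<in> U" by (rule cfun.subspace_diff[OF U(1) u(1) sU])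
  have in_l2: "u \<in> l2" "?s \<in> l2" "?w \<in> l2" using U(2) sU u w by auto
  have "?s \<in> cfun.span B"
    by (intro cfun.span_sum cfun.span_scale cfun.span_base)
  then have "?w \<noteq> 0" using u(2) by (metis right_minus_eq)
  then have pos: "l2_sqnorm ?w > 0"
    using l2_sqnorm_eq_0D[OF in_l2(3)] l2_sqnorm_nonneg[of ?w] by fastforce
  have orth: "l2_inner b ?w = 0" if "b \<in> B" for b
    using l2_inner_diff_right[OF _ in_l2(1,2)] orthonormal_inner_sum[OF B(1,2) Bl2 that] that Bl2 by auto
  define e where "e = pointwise_scale (complex_of_real (1 / sqrt (l2_sqnorm ?w))) ?w"
  have ee: "l2_inner e e = 1"
  proof -
    let ?c = "complex_of_real (1 / sqrt (l2_sqnorm ?w))"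
    have "l2_inner e e = cnj ?c * (?c * l2_inner ?w ?w)"
      unfolding e_def l2_inner_scale_left l2_inner_scale_right by (rule mult.left_commute)
    also have "\<dots> = complex_of_real (1 / sqrt (l2_sqnorm ?w) * (1 / sqrt (l2_sqnorm ?w)) * l2_sqnorm ?w)"
      by (simp only: l2_inner_self complex_cnj_complex_of_real of_real_mult mult.assoc)
    also have "1 / sqrt (l2_sqnorm ?w) * (1 / sqrt (l2_sqnorm ?w)) * l2_sqnorm ?w = 1"
      using pos by (simp add: field_simps flip: power2_eq_square)
    finally show ?thesis by simp
  qed
  have be: "l2_inner b e = 0" if "b \<in> B" for b
    unfolding e_def l2_inner_scale_right orth[OF that] by simp
  have eb: "l2_inner e b = 0" if "b \<in> B" for b
    using be[OF that] l2_inner_commute[of e b] by simp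
  have "e \<notin> B" using be ee by force
  moreover have "e \<in> U" unfolding e_def by (rule cfun.subspace_scale[OF U(1) w])
  moreover have "orthonormal (insert e B)"
    using B(1) ee be eb \<open>e \<notin> B\<close> unfolding orthonormal_def by auto
  ultimately show ?thesis by blast
qed

text \<open>Cardinalities of orthonormal sets in \<open>U\<close> are bounded by
  \<open>card A\<close>, so one of maximal cardinality exists; by the extension step it must span
  \<open>U\<close>.\<close>

lemma orthonormal_basis_exists:
  assumes U: "cfun.subspace U" "U \<subseteq> supported_on A" and A: "finite A"
  shows "\<exists>B. orthonormal B \<and> finite B \<and> B \<subseteq> U \<and> card B = cfun.dim U \<and> U \<subseteq> cfun.span B"
proof -
  have Ul2: "U \<subseteq> l2" using U(2) supported_on_subset_l2[OF A] by blast
  let ?P = "\<lambda>B. orthonormal B \<and> finite B \<and> B \<subseteq> U"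
  have bound: "card B \<le> card A" if "?P B" for B
  proof -
    have "B \<subseteq> cfun.span (delta ` A)"
      using that U(2) supported_on_span[OF A] by auto
    then have "card B \<le> card (delta ` A)"
      using cfun.independent_span_bound[of "delta ` A" B] orthonormal_independent[of B] that A Ul2 by auto
    then show ?thesis using card_image_le[OF A, of delta] by linarith
  qed
  have "?P {}" by (simp add: orthonormal_def)
  then obtain B where B: "?P B" "\<And>C. ?P C \<Longrightarrow> card C \<le> card B"
    using ex_has_greatest_nat[of ?P "{}" card "Suc (card A)"] bound by (auto simp: less_Suc_eq_le)
  have span: "U \<subseteq> cfun.span B"
  proof (rule ccontr)
    assume "\<not> U \<subseteq> cfun.span B"
    then obtain u where "u \<in> U" "u \<notin> cfun.span B" by blast
    then obtain e where "e \<in> U - B" "orthonormal (insert e B)"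
      using orthonormal_extend[of B U u] B(1) U(1) Ul2 by blast
    then show False using B(2)[of "insert e B"] B(1) by auto
  qed
  have "cfun.independent B" using B(1) Ul2 by (intro orthonormal_independent) auto
  then have "card B = cfun.dim U" using B(1) span by (intro cfun.basis_card_eq_dim) auto
  then show ?thesis using B(1) span by blast
qed

lemma orthonormal_basis_expand:
  assumes B: "orthonormal B" "finite B" "B \<subseteq> l2" and f: "f \<in> cfun.span B"
  shows "f = (\<Sum>e\<in>B. pointwise_scale (l2_inner e f) e)"
proof -
  obtain c where c: "f = (\<Sum>e\<in>B. pointwise_scale (c e) e)"
    using f cfun.span_finite[OF B(2)] by auto
  have "l2_inner e f = c e" if "e \<in> B" for e
    unfolding c by (rule orthonormal_inner_sum[OF B that])
  then show ?thesis using c by simp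
qed

text \<open>\<open>p x\<close> is the projection of \<open>delta x\<close> onto \<open>H\<close>,
  and \<open>l2_sqnorm (p x)\<close> equals the diagonal entry \<open>p x x\<close> of that
  projection. Summed over a finite set \<open>A\<close>, it is the trace of the projection cut down
  to \<open>A\<close>.\<close>

locale reproducing_kernel =
  fixes H :: "('v \<Rightarrow> complex) set" and p :: "'v \<Rightarrow> 'v \<Rightarrow> complex"
  assumes subspace: "cfun.subspace H" and sub_l2: "H \<subseteq> l2"
    and kernel_mem: "p x \<in> H"
    and reproducing: "h \<in> H \<Longrightarrow> l2_inner (p x) h = h x"
begin

lemma kernel_l2: "p x \<in> l2"
  using kernel_mem sub_l2 by blast

lemma kernel_diagonal: "p x x = complex_of_real (l2_sqnorm (p x))"
  using reproducing[OF kernel_mem] l2_inner_self by metis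

lemma kernel_commute: "p x y = cnj (p y x)"
  using reproducing[OF kernel_mem] l2_inner_commute by metis

text \<open>For an orthonormal basis of \<open>K\<close>, the sum of all
  \<open>(cmod (e x))\<^sup>2\<close> over \<open>A\<close> counts the basis, since its members live
  on \<open>A\<close>. At a fixed \<open>x\<close> the values \<open>e x\<close> are conjugates of
  \<open>l2_inner e (p x)\<close>, so Bessel's inequality bounds their contribution.\<close>

lemma dim_le_trace:
  assumes K: "cfun.subspace K" "K \<subseteq> H" "K \<subseteq> supported_on A" and A: "finite A"
  shows "cfun.dim K \<le> (\<Sum>x\<in>A. l2_sqnorm (p x))"
proof -
  obtain B where B: "orthonormal B" "finite B" "B \<subseteq> K" "card B = cfun.dim K"
    using orthonormal_basis_exists[OF K(1,3) A] by blast
  have Bl2: "B \<subseteq> l2" using B(3) K(2) sub_l2 by auto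
  have norm1: "(\<Sum>x\<in>A. (cmod (e x))\<^sup>2) = 1" if "e \<in> B" for e
  proof -
    have "e \<in> supported_on A" using B(3) K(3) that by auto
    moreover have "complex_of_real (l2_sqnorm e) = complex_of_real 1"
      using B(1) that unfolding l2_inner_self[symmetric] by (simp add: orthonormal_def)
    then have "l2_sqnorm e = 1" by (simp only: of_real_eq_iff)
    ultimately show ?thesis using l2_sqnorm_supported[OF A] by metis
  qed
  have "real (cfun.dim K) = (\<Sum>e\<in>B. \<Sum>x\<in>A. (cmod (e x))\<^sup>2)"
    using norm1 B(4) by simp
  also have "\<dots> = (\<Sum>x\<in>A. \<Sum>e\<in>B. (cmod (e x))\<^sup>2)"
    by (rule sum.swap)
  also have "\<dots> = (\<Sum>x\<in>A. \<Sum>e\<in>B. (cmod (l2_inner e (p x)))\<^sup>2)"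
  proof (intro sum.cong refl)
    fix x e assume "e \<in> B"
    then have "e \<in> H" using B(3) K(2) by auto
    then have "l2_inner e (p x) = cnj (e x)"
      using l2_inner_commute[of e "p x"] reproducing by simp
    then show "(cmod (e x))\<^sup>2 = (cmod (l2_inner e (p x)))\<^sup>2" by simp
  qed
  also have "\<dots> \<le> (\<Sum>x\<in>A. l2_sqnorm (p x))"
    by (intro sum_mono orthonormal_bessel B Bl2 kernel_l2)
  finally show ?thesis .
qed

text \<open>The trace over \<open>A\<close> is computed in an orthonormal basis \<open>B\<close> of
  the restrictions, where each basis vector contributes the squared norm of its projection to
  \<open>H\<close>, hence at most 1.\<close>

lemma trace_le_dim:
  assumes A: "finite A"
  shows "(\<Sum>x\<in>A. l2_sqnorm (p x)) \<le> cfun.dim (restrict_to A ` H)"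
proof -
  let ?U = "restrict_to A ` H"
  have US: "?U \<subseteq> supported_on A" by (auto simp: restrict_to_def supported_on_def)
  have "cfun.subspace ?U" by (intro subspace_clinear_image clinear_on_restrict_to subspace)
  from orthonormal_basis_exists[OF this US A]
  obtain B where B: "orthonormal B" "finite B" "B \<subseteq> ?U" "card B = cfun.dim ?U" "?U \<subseteq> cfun.span B"
    by blast
  have BS: "B \<subseteq> supported_on A" using B(3) US by auto
  have Bl2: "B \<subseteq> l2" using BS supported_on_subset_l2[OF A] by auto
  \<comment> \<open>For \<open>e\<close> supported on \<open>A\<close> this finite combination is
    the orthogonal projection of \<open>e\<close> onto \<open>H\<close>: by \<open>inner_g\<close>
    it has the same inner products with members of \<open>H\<close> as \<open>e\<close>.\<close>
  define g where "g e = (\<Sum>y\<in>A. pointwise_scale (e y) (p y))" for e :: "'v \<Rightarrow> complex"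
  have gH: "g e \<in> H" for e
    unfolding g_def by (intro cfun.subspace_sum[OF subspace] cfun.subspace_scale[OF subspace] kernel_mem)
  have inner_g: "l2_inner (g e) h = (\<Sum>y\<in>A. cnj (e y) * h y)" if "h \<in> H" for e h
  proof -
    have "l2_inner (g e) h = (\<Sum>y\<in>A. l2_inner (pointwise_scale (e y) (p y)) h)"
      unfolding g_def using that sub_l2 by (intro l2_inner_sum_left l2_scale kernel_l2) auto
    then show ?thesis by (simp add: l2_inner_scale_left reproducing[OF that])
  qed
  have e_g: "l2_inner e (g e) = l2_inner (g e) (g e)" if "e \<in> B" for e
    using inner_g[OF gH] l2_inner_supported[OF A] BS that by (metis subsetD)
  have e_p: "l2_inner e (p x) = cnj (g e x)" if "e \<in> B" for e x
  proof -
    have "l2_inner e (p x) = (\<Sum>y\<in>A. cnj (e y) * p x y)"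
      using l2_inner_supported[OF A] BS that by blast
    also have "\<dots> = cnj (g e x)"
      unfolding g_def sum_fun_apply pointwise_scale_def cnj_sum
      by (intro sum.cong refl) (simp add: kernel_commute[of x])
    finally show ?thesis .
  qed
  \<comment> \<open>Expanding the restriction of \<open>p x\<close> to \<open>A\<close> in the basis
    \<open>B\<close>, with coefficients \<open>cnj (g e x)\<close>, expresses the diagonal
    entry.\<close>
  have diag: "p x x = (\<Sum>e\<in>B. cnj (g e x) * e x)" if "x \<in> A" for x
  proof -
    have r: "restrict_to A (p x) \<in> cfun.span B" using B(5) kernel_mem by blast
    have "p x x = restrict_to A (p x) x" using that by (simp add: restrict_to_def)
    also have "\<dots> = (\<Sum>e\<in>B. pointwise_scale (l2_inner e (restrict_to A (p x))) e) x"
      using orthonormal_basis_expand[OF B(1,2) Bl2 r] by simp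
    also have "\<dots> = (\<Sum>e\<in>B. l2_inner e (restrict_to A (p x)) * e x)"
      by (simp add: sum_fun_apply pointwise_scale_def)
    also have "\<dots> = (\<Sum>e\<in>B. cnj (g e x) * e x)"
    proof (intro sum.cong refl)
      fix e assume e: "e \<in> B"
      have es: "e \<in> supported_on A" using BS e by blast
      have "l2_inner e (restrict_to A (p x)) = l2_inner e (p x)"
        unfolding l2_inner_supported[OF A es] by (intro sum.cong) (auto simp: restrict_to_def)
      then show "l2_inner e (restrict_to A (p x)) * e x = cnj (g e x) * e x"
        using e_p[OF e] by simp
    qed
    finally show ?thesis .
  qed
  have "complex_of_real (\<Sum>x\<in>A. l2_sqnorm (p x)) = (\<Sum>x\<in>A. \<Sum>e\<in>B. cnj (g e x) * e x)"
    unfolding of_real_sum kernel_diagonal[symmetric] by (intro sum.cong refl diag)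
  also have "\<dots> = (\<Sum>e\<in>B. \<Sum>x\<in>A. cnj (g e x) * e x)" by (rule sum.swap)
  also have "\<dots> = (\<Sum>e\<in>B. cnj (l2_inner e (g e)))"
  proof (intro sum.cong refl)
    fix e assume "e \<in> B"
    then have es: "e \<in> supported_on A" using BS by blast
    show "(\<Sum>x\<in>A. cnj (g e x) * e x) = cnj (l2_inner e (g e))"
      unfolding l2_inner_supported[OF A es] cnj_sum by (simp add: mult.commute)
  qed
  also have "\<dots> = complex_of_real (\<Sum>e\<in>B. l2_sqnorm (g e))"
    unfolding of_real_sum by (intro sum.cong refl) (simp add: e_g l2_inner_self)
  finally have "(\<Sum>x\<in>A. l2_sqnorm (p x)) = (\<Sum>e\<in>B. l2_sqnorm (g e))"
    by (simp only: of_real_eq_iff)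
  \<comment> \<open>Each term is at most 1 because
    \<open>0 \<le> l2_sqnorm (e - g e) = 1 - l2_sqnorm (g e)\<close>.\<close>
  also have "\<dots> \<le> (\<Sum>e\<in>B. 1)"
  proof (rule sum_mono)
    fix e assume e: "e \<in> B"
    have "complex_of_real (l2_sqnorm e) = complex_of_real 1"
      using B(1) e unfolding l2_inner_self[symmetric] by (simp add: orthonormal_def)
    then have "l2_sqnorm e = 1" by (simp only: of_real_eq_iff)
    moreover have "e \<in> l2" "g e \<in> l2" using e Bl2 gH sub_l2 by auto
    moreover have "Re (l2_inner e (g e)) = l2_sqnorm (g e)"
      using e_g[OF e] by (simp add: l2_inner_self)
    ultimately show "l2_sqnorm (g e) \<le> 1"
      using l2_sqnorm_diff[of e "g e"] l2_sqnorm_nonneg[of "e - g e"] by simp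
  qed
  finally show ?thesis using B(4) by simp
qed

end

subsection \<open>The eigenspace of a periodic operator\<close>

lemma linear_betweenD:
  assumes "linear_between s t M N f"
  shows "x \<in> M \<Longrightarrow> f x \<in> N"
    and "x \<in> M \<Longrightarrow> y \<in> M \<Longrightarrow> f (x + y) = f x + f y"
    and "x \<in> M \<Longrightarrow> f (s a x) = t a (f x)"
  using assms by (auto simp: linear_between_def)

locale periodic_operator = periodic_graph E act
  for E :: "('v \<times> 'v) set" and act :: "int ^ 'd::finite \<Rightarrow> 'v \<Rightarrow> 'v" +
  fixes W :: "'v set" and D :: "('v \<Rightarrow> complex) \<Rightarrow> 'v \<Rightarrow> complex" and \<mu> :: complex
  assumes fundamental: "fundamental_domain act W"
    and operator: "l2_operator D"
    and order: "finite_order E D"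
    and commutes: "commutes_with_action act D"
begin

section \<open>Orbits and blocks of vertices\<close>

lemma orbit_unique:
  assumes "w \<in> W" "w' \<in> W" "act g w = act h w'"
  shows "w = w'"
proof -
  have "w' = act (- h + g) w"
    using assms(3) act_add[of "- h" g w] act_add[of "- h" h w'] act_zero by simp
  then have w': "w' \<in> range (\<lambda>g. act g w)" by (rule range_eqI)
  have w: "w \<in> range (\<lambda>g. act g w)"
    using act_zero[of w] range_eqI[of w "\<lambda>g. act g w" 0] by simp
  have "range (\<lambda>g. act g w) \<in> orbits act" by (auto simp: orbits_def)
  then have "\<exists>!u. u \<in> W \<and> u \<in> range (\<lambda>g. act g w)"
    using fundamental by (simp add: fundamental_domain_def)
  then obtain u where u: "\<forall>y. y \<in> W \<and> y \<in> range (\<lambda>g. act g w) \<longrightarrow> y = u"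
    by (elim ex1E)
  show ?thesis
    using mp[OF spec[OF u, of w] conjI[OF assms(1) w]] mp[OF spec[OF u, of w'] conjI[OF assms(2) w']]
    by simp
qed

lemma vertex_cases: obtains g w where "w \<in> W" "v = act g w"
proof -
  have "range (\<lambda>g. act g v) \<in> orbits act" by (auto simp: orbits_def)
  then have "\<exists>!u. u \<in> W \<and> u \<in> range (\<lambda>g. act g v)"
    using fundamental by (simp add: fundamental_domain_def)
  then obtain w where "w \<in> W" "w \<in> range (\<lambda>g. act g v)" by (elim ex1E conjE)
  then obtain g where "w = act g v" by (elim rangeE)
  then have "v = act (- g) w" using act_add[of "- g" g v] act_zero by simp
  then show thesis by (rule that[OF \<open>w \<in> W\<close>])
qed

lemma bij_orbits: "bij_betw (\<lambda>w. range (\<lambda>g. act g w)) W (orbits act)"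
  unfolding bij_betw_def
proof
  show "inj_on (\<lambda>w. range (\<lambda>g. act g w)) W"
  proof (rule inj_onI)
    fix w w' assume *: "w \<in> W" "w' \<in> W" "range (\<lambda>g. act g w) = range (\<lambda>g. act g w')"
    have "act 0 w \<in> range (\<lambda>g. act g w')" unfolding *(3)[symmetric] by (rule rangeI)
    then show "w = w'" using orbit_unique[OF *(1,2)] by blast
  qed
  show "(\<lambda>w. range (\<lambda>g. act g w)) ` W = orbits act"
  proof (rule subset_antisym)
    show "orbits act \<subseteq> (\<lambda>w. range (\<lambda>g. act g w)) ` W"
    proof
      fix B assume "B \<in> orbits act"
      then obtain v where v: "B = range (\<lambda>g. act g v)" by (auto simp: orbits_def)
      obtain g w where gw: "w \<in> W" "v = act g w" by (rule vertex_cases)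
      have "act h v = act (h + g) w" for h by (simp add: gw(2) act_add)
      moreover have "act h w = act (h - g) v" for h by (simp add: gw(2) act_add[symmetric])
      ultimately have "B = range (\<lambda>g. act g w)" unfolding v by (metis (no_types) image_subset_iff rangeI subset_antisym)
      then show "B \<in> (\<lambda>w. range (\<lambda>g. act g w)) ` W" using gw(1) by blast
    qed
  qed (auto simp: orbits_def)
qed

lemma card_W: "card W = card (orbits act)"
  by (rule bij_betw_same_card[OF bij_orbits])

sublocale V: free_cofinite_action act W
proof
  show "finite W" using bij_betw_finite[OF bij_orbits] finite_orbits by simp
  fix g h w w' assume *: "w \<in> W" "w' \<in> W" "act g w = act h w'"
  then have "w = w'" by (rule orbit_unique)
  moreover from this have "act (- h + g) w = w"
    using *(3) act_add[of "- h" g w] act_add[of "- h" h w'] act_zero by simp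
  then have "- h + g = 0" by (rule act_free)
  ultimately show "g = h \<and> w = w'" by (simp add: eq_neg_iff_add_eq_0 neg_eq_iff_add_eq_0)
qed (rule act_zero act_add)+

lemma vertex_in_block: "\<exists>N. v \<in> V.block N"
proof -
  obtain g w where "w \<in> W" "v = act g w" by (rule vertex_cases)
  then show ?thesis using cube_exhausts[of g] V.block_memI by blast
qed

lemma finite_subset_block:
  assumes "finite A"
  shows "\<exists>N. A \<subseteq> V.block N"
  using assms
proof (induction A rule: finite_induct)
  case (insert v A)
  then obtain N where N: "A \<subseteq> V.block N" by auto
  obtain M where M: "v \<in> V.block M" using vertex_in_block by blast
  have "insert v A \<subseteq> V.block (max M N)"
    using M N V.block_mono[of M "max M N"] V.block_mono[of N "max M N"] by auto
  then show ?case by blast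
qed auto

text \<open>Every vertex lies in some block because the fundamental domain meets every orbit; so the
  space attached to the locale is the one in the definition of
  \<open>finsupp_eigenspace\<close>.\<close>

lemma finsupp_iff: "f \<in> V.finsupp \<longleftrightarrow> finite {v. f v \<noteq> 0}"
proof
  assume "f \<in> V.finsupp"
  then obtain N where "f \<in> supported_on (V.block N)" by (auto simp: V.finsupp_def)
  then have "{v. f v \<noteq> 0} \<subseteq> V.block N" by (auto simp: supported_on_def)
  then show "finite {v. f v \<noteq> 0}" by (rule finite_subset[OF _ V.finite_block])
next
  assume "finite {v. f v \<noteq> 0}"
  from finite_subset_block[OF this] obtain N where "{v. f v \<noteq> 0} \<subseteq> V.block N" ..
  then have "f \<in> supported_on (V.block N)" by (auto simp: supported_on_def)
  then show "f \<in> V.finsupp" using V.supported_block_subset_finsupp by blast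
qed

lemma finsupp_subset_l2: "V.finsupp \<subseteq> l2"
  unfolding V.finsupp_def using supported_on_subset_l2[OF V.finite_block] by blast

section \<open>Locality of the operator\<close>

definition range_of :: "nat" where
  "range_of = (SOME r. has_order E D r)"

text \<open>The vertex itself is inserted because the order may be \<open>0\<close>.\<close>

definition nbhd :: "'v \<Rightarrow> 'v set" where
  "nbhd v = insert v {w. path_dist E w v < enat range_of}"

lemma D_local:
  assumes "f \<in> l2" "h \<in> l2" "\<And>w. w \<in> nbhd v \<Longrightarrow> f w = h w"
  shows "D f v = D h v"
proof -
  have "has_order E D range_of"
    unfolding range_of_def by (rule someI_ex) (use order in \<open>simp add: finite_order_def\<close>)
  then show ?thesis using assms unfolding has_order_def nbhd_def by blast
qed

lemma path_dist_less_iff: "path_dist E w v < enat m \<longleftrightarrow> (\<exists>n<m. (w, v) \<in> E ^^ n)"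
  unfolding path_dist_def Inf_less_iff by auto

lemma finite_walks_to: "finite {w. (w, v) \<in> E ^^ n}"
proof (induction n arbitrary: v)
  case (Suc n)
  \<comment> \<open>A walk is split at its last edge, which is reversed by symmetry so that local
    finiteness applies at \<open>v\<close>.\<close>
  have "{w. (w, v) \<in> E ^^ Suc n} = (\<Union>u\<in>{u. (v, u) \<in> E}. {w. (w, u) \<in> E ^^ n})"
    using edges_sym by (auto simp: sym_def)
  then show ?case using Suc locally_finite by simp
qed simp

lemma finite_nbhd: "finite (nbhd v)"
proof -
  have "{w. path_dist E w v < enat range_of} = (\<Union>n<range_of. {w. (w, v) \<in> E ^^ n})"
    unfolding path_dist_less_iff by auto
  then show ?thesis unfolding nbhd_def using finite_walks_to by simp
qed

lemma act_walk: "(w, v) \<in> E ^^ n \<Longrightarrow> (act g w, act g v) \<in> E ^^ n"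
proof (induction n arbitrary: v)
  case (Suc n)
  then obtain u where "(w, u) \<in> E ^^ n" "(u, v) \<in> E" by auto
  then have "(act g w, act g u) \<in> E ^^ n" "(act g u, act g v) \<in> E"
    by (auto intro: Suc.IH act_edges)
  then show ?case by auto
qed simp

lemma nbhd_act: "nbhd (act g v) \<subseteq> act g ` nbhd v"
proof
  fix u assume "u \<in> nbhd (act g v)"
  then have "act (- g) u \<in> nbhd v"
    using act_walk[of u "act g v" _ "- g"] by (auto simp: nbhd_def path_dist_less_iff)
  then have "act g (act (- g) u) \<in> act g ` nbhd v" by (rule imageI)
  then show "u \<in> act g ` nbhd v" by simp
qed

text \<open>Equivariance reduces neighbourhoods to those of the finitely many vertices of
  \<open>W\<close>. The resulting \<open>c\<close> is the width that governs the boundary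
  estimates.\<close>

lemma nbhd_uniform: "\<exists>c. \<forall>g. \<forall>w\<in>W. nbhd (act g w) \<subseteq> act g ` V.block c"
proof -
  have "finite (\<Union>w\<in>W. nbhd w)" using finite_nbhd V.finite_W by simp
  then obtain c where c: "(\<Union>w\<in>W. nbhd w) \<subseteq> V.block c" using finite_subset_block by blast
  have "nbhd (act g w) \<subseteq> act g ` V.block c" if "w \<in> W" for g w
    using nbhd_act[of g w] c that by blast
  then show ?thesis by blast
qed

lemma clinear_D: "clinear_on l2 D"
  using operator unfolding l2_operator_def linear_between_def by blast

lemma D_zero: "D 0 = 0"
  by (rule clinear_on_0[OF clinear_D subspace_l2])

text \<open>By locality \<open>f\<close> may be cut off to the finite set \<open>nbhd v\<close>
  before evaluating at \<open>v\<close>; linearity then exhibits \<open>D\<close> as a matrix with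
  finite rows.\<close>

lemma D_finite_sum:
  assumes f: "f \<in> l2"
  shows "D f v = (\<Sum>w\<in>nbhd v. f w * D (delta w) v)"
proof -
  let ?h = "restrict_to (nbhd v) f"
  have hs: "?h \<in> supported_on (nbhd v)" by (simp add: restrict_to_def supported_on_def)
  have hl2: "?h \<in> l2" using hs supported_on_subset_l2[OF finite_nbhd] by blast
  have "D f v = D ?h v" by (rule D_local[OF f hl2]) (simp add: restrict_to_def)
  also have "D ?h = D (\<Sum>w\<in>nbhd v. pointwise_scale (?h w) (delta w))"
    using supported_on_expand[OF finite_nbhd hs] by simp
  also have "\<dots> = (\<Sum>w\<in>nbhd v. D (pointwise_scale (?h w) (delta w)))"
    by (intro clinear_on_sum[OF clinear_D subspace_l2] l2_scale delta_l2)
  also have "\<dots> = (\<Sum>w\<in>nbhd v. pointwise_scale (?h w) (D (delta w)))"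
    by (intro sum.cong refl clinear_onD(2)[OF clinear_D] delta_l2)
  finally show ?thesis by (simp add: sum_fun_apply pointwise_scale_def restrict_to_def)
qed

section \<open>The eigenspace and the kernel of its projection\<close>

abbreviation H where "H \<equiv> l2_eigenspace D \<mu>"
abbreviation K where "K \<equiv> finsupp_eigenspace D \<mu>"

lemma eigenspace_subset_l2: "H \<subseteq> l2"
  by (auto simp: l2_eigenspace_def)

lemma subspace_eigenspace: "cfun.subspace H"
proof (rule cfun.subspaceI)
  show "0 \<in> H" by (simp add: l2_eigenspace_def D_zero)
next
  fix f h assume "f \<in> H" "h \<in> H"
  then show "f + h \<in> H"
    using clinear_onD(1)[OF clinear_D, of f h]
    by (simp add: l2_eigenspace_def l2_add cfun.scale_right_distrib)
next
  fix c f assume "f \<in> H"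
  then show "pointwise_scale c f \<in> H"
    using clinear_onD(2)[OF clinear_D, of f c]
    by (simp add: l2_eigenspace_def l2_scale mult.commute)
qed

text \<open>Each coordinate of the eigenvalue equation involves finitely many values, so it survives
  pointwise limits; this takes the place of continuity of \<open>D\<close>.\<close>

lemma pointwise_closed_eigenspace: "pointwise_closed H"
  unfolding pointwise_closed_def
proof (intro allI impI, elim conjE)
  fix s h assume s: "\<forall>n. s n \<in> H" and h: "h \<in> l2" and lim: "\<forall>v. (\<lambda>n. s n v) \<longlonglongrightarrow> h v"
  have "D h v = \<mu> * h v" for v
  proof -
    have "(\<lambda>n. \<Sum>w\<in>nbhd v. s n w * D (delta w) v) \<longlonglongrightarrow> (\<Sum>w\<in>nbhd v. h w * D (delta w) v)"
      using lim by (intro tendsto_intros) auto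
    moreover have "(\<Sum>w\<in>nbhd v. s n w * D (delta w) v) = \<mu> * s n v" for n
    proof -
      have sn: "s n \<in> l2" "D (s n) = pointwise_scale \<mu> (s n)" using s by (auto simp: l2_eigenspace_def)
      show ?thesis unfolding D_finite_sum[OF sn(1), symmetric] sn(2) by (simp add: pointwise_scale_def)
    qed
    moreover have "(\<lambda>n. \<mu> * s n v) \<longlonglongrightarrow> \<mu> * h v"
      using lim by (intro tendsto_intros) auto
    ultimately show ?thesis
      unfolding D_finite_sum[OF h] using LIMSEQ_unique by auto
  qed
  then show "h \<in> H" using h by (simp add: l2_eigenspace_def pointwise_scale_def fun_eq_iff)
qed

lemma bij_act: "bij (act g)"
  by (rule bij_betw_byWitness[where f' = "act (- g)"]) auto

lemma translate_l2:
  assumes "f \<in> l2"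
  shows "translate act g f \<in> l2"
  using assms summable_on_reindex_bij_betw[OF bij_act[of "- g"], of "\<lambda>v. (cmod (f v))\<^sup>2"]
  by (simp add: l2_def translate_def)

lemma l2_inner_translate: "l2_inner (translate act g f) (translate act g h) = l2_inner f h"
  unfolding l2_inner_def translate_def
  by (rule infsum_reindex_bij_betw[OF bij_act[of "- g"], of "\<lambda>v. cnj (f v) * h v"])

lemma translate_eigenspace:
  assumes "f \<in> H"
  shows "translate act g f \<in> H"
proof -
  have f: "f \<in> l2" "D f = pointwise_scale \<mu> f" using assms by (auto simp: l2_eigenspace_def)
  have "D (translate act g f) = translate act g (D f)"
    using commutes f(1) unfolding commutes_with_action_def by simp
  also have "\<dots> = pointwise_scale \<mu> (translate act g f)"
    by (simp add: f(2) translate_def pointwise_scale_def)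
  finally show ?thesis using translate_l2[OF f(1)] by (simp add: l2_eigenspace_def)
qed

text \<open>The column at \<open>x\<close> of the projection \<open>E({\<lambda>})\<close>, which
  turns out to be the reproducing kernel of the eigenspace.\<close>

definition eker :: "'v \<Rightarrow> 'v \<Rightarrow> complex" where
  "eker x = orth_proj H (delta x)"

lemma eker: "eker x \<in> H \<and> (\<forall>h\<in>H. l2_inner h (delta x - eker x) = 0)"
proof -
  obtain g where g: "g \<in> H" "\<forall>h\<in>H. l2_inner h (delta x - g) = 0"
    using l2_orthogonal_projection_exists[OF subspace_eigenspace eigenspace_subset_l2
        pointwise_closed_eigenspace delta_l2[of x]] by blast
  have "eker x = g"
    unfolding eker_def by (rule orth_proj_unique[OF subspace_eigenspace eigenspace_subset_l2 delta_l2 g])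
  then show ?thesis using g by simp
qed

sublocale H: reproducing_kernel H eker
proof
  fix x h assume h: "h \<in> H"
  have "l2_inner h (delta x - eker x) = l2_inner h (delta x) - l2_inner h (eker x)"
    using h eker[of x] eigenspace_subset_l2 by (intro l2_inner_diff_right delta_l2) auto
  then have "l2_inner h (eker x) = cnj (h x)"
    using eker[of x] h by (simp add: l2_inner_delta_right)
  then show "l2_inner (eker x) h = h x"
    using l2_inner_commute[of "eker x" h] by simp
qed (use eker subspace_eigenspace eigenspace_subset_l2 in auto)

text \<open>Translation preserves the eigenspace and the inner product, so the translate of
  \<open>eker x\<close> satisfies the conditions that characterise the projection of
  \<open>delta (act g x)\<close>.\<close>

lemma eker_act: "eker (act g x) = translate act g (eker x)"
  unfolding eker_def[of "act g x"]
proof (rule orth_proj_unique[OF subspace_eigenspace eigenspace_subset_l2 delta_l2])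
  show "translate act g (eker x) \<in> H" by (rule translate_eigenspace[OF H.kernel_mem])
  show "\<forall>h\<in>H. l2_inner h (delta (act g x) - translate act g (eker x)) = 0"
  proof
    fix h assume h: "h \<in> H"
    have "delta (act g x) - translate act g (eker x) = translate act g (delta x - eker x)"
      unfolding V.translate_delta[symmetric] by (simp add: translate_def fun_eq_iff)
    moreover have "h = translate act g (translate act (- g) h)"
      by (simp add: translate_def)
    ultimately have "l2_inner h (delta (act g x) - translate act g (eker x))
        = l2_inner (translate act (- g) h) (delta x - eker x)"
      using l2_inner_translate by metis
    then show "l2_inner h (delta (act g x) - translate act g (eker x)) = 0"
      using eker[of x] translate_eigenspace[OF h] by simp
  qed
qed

lemma eker_diagonal_act: "l2_sqnorm (eker (act g x)) = l2_sqnorm (eker x)"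
proof -
  have "complex_of_real (l2_sqnorm (eker (act g x))) = complex_of_real (l2_sqnorm (eker x))"
    unfolding l2_inner_self[symmetric] eker_act l2_inner_translate ..
  then show ?thesis by (simp only: of_real_eq_iff)
qed

text \<open>\<open>restrict_to W\<close> annihilates \<open>delta v\<close> for \<open>v\<close>
  outside \<open>W\<close>, which leaves the diagonal entries over \<open>W\<close>.\<close>

lemma density_of_states_eq:
  "density_of_states D W \<mu> = 1 / of_nat (card W) * complex_of_real (\<Sum>w\<in>W. l2_sqnorm (eker w))"
proof -
  let ?T = "orth_proj H \<circ> restrict_to W"
  have T: "l2_inner (delta v) (?T (delta v)) = (if v \<in> W then complex_of_real (l2_sqnorm (eker v)) else 0)" for v
  proof (cases "v \<in> W")
    case True
    then have "restrict_to W (delta v) = delta v" by (auto simp: restrict_to_def delta_def)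
    then have "?T (delta v) = eker v" by (simp add: eker_def)
    then show ?thesis using True by (simp only: l2_inner_delta H.kernel_diagonal if_True)
  next
    case False
    then have "restrict_to W (delta v) = 0" by (auto simp: restrict_to_def delta_def fun_eq_iff)
    \<comment> \<open>\<open>orth_proj\<close> is a definite description, so even its value at 0 has
      to be computed.\<close>
    moreover have "orth_proj H 0 = 0"
      by (rule orth_proj_unique[OF subspace_eigenspace eigenspace_subset_l2 l2_0])
        (simp_all add: cfun.subspace_0[OF subspace_eigenspace])
    ultimately show ?thesis using False by (simp add: l2_inner_delta)
  qed
  have "l2_trace ?T = (\<Sum>\<^sub>\<infinity>v\<in>W. complex_of_real (l2_sqnorm (eker v)))"
    unfolding l2_trace_def T by (intro infsum_cong_neutral) auto
  also have "\<dots> = complex_of_real (\<Sum>w\<in>W. l2_sqnorm (eker w))"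
    using V.finite_W by simp
  finally show ?thesis by (simp add: density_of_states_def)
qed

lemma finsupp_eigenspace_eq: "K = H \<inter> V.finsupp"
  using finsupp_subset_l2 finsupp_iff by (auto simp: finsupp_eigenspace_def l2_eigenspace_def)

lemma invariant_finsupp_eigenspace: "V.invariant_subspace K"
  unfolding V.invariant_subspace_def finsupp_eigenspace_eq
  using translate_eigenspace V.translate_finsupp
  by (auto intro!: cfun.subspace_inter subspace_eigenspace V.subspace_finsupp)

section \<open>Comparison of trace and density\<close>

lemma trace_block:
  "(\<Sum>x\<in>V.block N. l2_sqnorm (eker x)) = cube_vol CARD('d) N * (\<Sum>w\<in>W. l2_sqnorm (eker w))"
proof -
  have "inj_on (\<lambda>(g, w). act g w) (cube N \<times> W)"
    using V.act_eqD by (fastforce simp: inj_on_def)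
  then have "(\<Sum>x\<in>V.block N. l2_sqnorm (eker x))
      = (\<Sum>(g, w)\<in>(cube N :: (int ^ 'd) set) \<times> W. l2_sqnorm (eker w))"
    unfolding V.block_def by (subst sum.reindex) (simp_all add: case_prod_unfold eker_diagonal_act)
  also have "\<dots> = (\<Sum>g\<in>(cube N :: (int ^ 'd) set). \<Sum>w\<in>W. l2_sqnorm (eker w))"
    by (rule sum.cartesian_product[symmetric])
  finally show ?thesis by (simp add: card_cube)
qed

text \<open>The neighbourhood of a vertex either lies in the block of radius \<open>N\<close>, where the cut-off
  function agrees with \<open>h\<close>, or misses the block of radius \<open>N - 2 c\<close>, where it is supported.\<close>

lemma cut_off_eigenfunction:
  assumes c: "\<And>g w. w \<in> W \<Longrightarrow> nbhd (act g w) \<subseteq> act g ` V.block c"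
    and N: "2 * c \<le> N" and h: "h \<in> H"
    and vanish: "\<And>x. x \<in> V.block N \<Longrightarrow> x \<notin> V.block (N - 2 * c) \<Longrightarrow> h x = 0"
  shows "restrict_to (V.block N) h \<in> K"
proof -
  let ?f = "restrict_to (V.block N) h"
  have fs: "?f \<in> supported_on (V.block N)" by (simp add: restrict_to_def supported_on_def)
  have fl2: "?f \<in> l2" using fs supported_on_subset_l2[OF V.finite_block] by blast
  have hl2: "h \<in> l2" "D h = pointwise_scale \<mu> h" using h by (auto simp: l2_eigenspace_def)
  have "D ?f v = \<mu> * ?f v" for v
  proof -
    obtain g w where v: "w \<in> W" "v = act g w" by (rule vertex_cases)
    have nb: "nbhd v \<subseteq> act g ` V.block c" using c v by blast
    have vv: "v \<in> nbhd v" by (simp add: nbhd_def)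
    \<comment> \<open>The radius \<open>N - c\<close> separates the cases. For \<open>g\<close>
      inside it the neighbourhood stays in the block of radius \<open>N\<close>; a neighbour in the
      block of radius \<open>N - 2 * c\<close> would force \<open>g\<close> inside it, since
      \<open>N - 2 * c + c = N - c\<close>.\<close>
    show ?thesis
    proof (cases "g \<in> cube (N - c)")
      case True
      have "act g ` V.block c \<subseteq> V.block (N - c + c)" by (rule V.act_block_subset[OF True])
      then have "nbhd v \<subseteq> V.block N" using nb N by simp
      then have eq: "?f u = h u" if "u \<in> nbhd v" for u using that by (auto simp: restrict_to_def)
      have "D ?f v = D h v" by (rule D_local[OF fl2 hl2(1) eq])
      then show ?thesis using eq[OF vv] by (simp add: hl2(2) pointwise_scale_def)
    next
      case False
      have disj: "act g x \<notin> V.block (N - 2 * c)" if x: "x \<in> V.block c" for x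
      proof
        assume "act g x \<in> V.block (N - 2 * c)"
        then obtain b w' where b: "b \<in> cube (N - 2 * c)" "w' \<in> W" "act g x = act b w'"
          by (auto simp: V.block_def)
        obtain a w'' where a: "a \<in> cube c" "w'' \<in> W" "x = act a w''"
          using x by (auto simp: V.block_def)
        have "act (g + a) w'' = act b w'" using b(3) a(3) by (simp add: act_add)
        then have "g + a = b" using V.act_eqD[OF a(2) b(2)] by blast
        then have "g = b + - a" by (simp add: algebra_simps)
        then have "g \<in> cube (N - 2 * c + c)"
          using cube_add[OF b(1) cube_uminus[OF a(1)]] by simp
        then show False using False N by simp
      qed
      have eq: "?f u = 0 u" if "u \<in> nbhd v" for u
      proof -
        \<comment> \<open>Outside the smaller block \<open>?f\<close> vanishes either by the cut-off
          or by \<open>vanish\<close>.\<close>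
        have "u \<notin> V.block (N - 2 * c)" using that nb disj by blast
        then show ?thesis using vanish by (simp add: restrict_to_def)
      qed
      have "D ?f v = D 0 v" by (rule D_local[OF fl2 l2_0 eq])
      then show ?thesis using eq[OF vv] by (simp add: D_zero)
    qed
  qed
  then have "D ?f = pointwise_scale \<mu> ?f" by (simp add: pointwise_scale_def fun_eq_iff)
  then have "?f \<in> H" using fl2 by (simp add: l2_eigenspace_def)
  moreover have "?f \<in> V.finsupp" using fs V.supported_block_subset_finsupp by blast
  ultimately show ?thesis by (simp add: finsupp_eigenspace_eq)
qed

text \<open>Rank and nullity are applied to restriction to the boundary shell \<open>?Y\<close>: its
  kernel consists of cut-offs that are finitely supported eigenfunctions, and its rank is at most
  the number of points of the shell.\<close>

lemma dim_restricted_eigenspace_le: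
  assumes c: "\<And>g w. w \<in> W \<Longrightarrow> nbhd (act g w) \<subseteq> act g ` V.block c" and N: "2 * c \<le> N"
  shows "cfun.dim (restrict_to (V.block N) ` H)
    \<le> cfun.dim (K \<inter> supported_on (V.block N)) + card (V.block N - V.block (N - 2 * c))"
proof -
  let ?U = "restrict_to (V.block N) ` H" and ?Y = "V.block N - V.block (N - 2 * c)"
  have US: "?U \<subseteq> supported_on (V.block N)" by (auto simp: restrict_to_def supported_on_def)
  have "cfun.subspace ?U" by (intro subspace_clinear_image clinear_on_restrict_to subspace_eigenspace)
  from dim_image_kernel_supported[OF clinear_on_restrict_to this US V.finite_block, of ?Y]
  have "cfun.dim ?U = cfun.dim (kernel_on ?U (restrict_to ?Y)) + cfun.dim (restrict_to ?Y ` ?U)"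
    by simp
  moreover have "cfun.dim (kernel_on ?U (restrict_to ?Y)) \<le> cfun.dim (K \<inter> supported_on (V.block N))"
  proof (rule dim_mono_supported[OF _ Int_lower2 V.finite_block], rule subsetI)
    fix f assume f: "f \<in> kernel_on ?U (restrict_to ?Y)"
    then obtain h where h: "h \<in> H" "f = restrict_to (V.block N) h" by (auto simp: kernel_on_def)
    have "h x = 0" if "x \<in> V.block N" "x \<notin> V.block (N - 2 * c)" for x
    proof -
      have "restrict_to ?Y f x = 0" using f by (simp add: kernel_on_def)
      then show ?thesis using that h(2) by (simp add: restrict_to_def)
    qed
    then have "f \<in> K" unfolding h(2) by (intro cut_off_eigenfunction[OF c N h(1)])
    moreover have "f \<in> supported_on (V.block N)" using f US by (auto simp: kernel_on_def)
    ultimately show "f \<in> K \<inter> supported_on (V.block N)" by blast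
  qed
  moreover have "cfun.dim (restrict_to ?Y ` ?U) \<le> card ?Y"
    by (rule dim_le_card_supported) (auto simp: restrict_to_def supported_on_def)
  ultimately show ?thesis by linarith
qed

text \<open>Dividing both trace bounds over a block by the number of points of the cube encloses the
  trace over \<open>W\<close> between the density and the density plus a boundary term that tends to
  0.\<close>

lemma trace_eq_density: "(\<Sum>w\<in>W. l2_sqnorm (eker w)) = (SUP N. V.density K N)"
proof -
  let ?t = "\<Sum>w\<in>W. l2_sqnorm (eker w)" and ?q = "cube_vol CARD('d)"
  have lim: "V.density K \<longlonglongrightarrow> (SUP N. V.density K N)"
    by (rule V.density_tendsto[OF invariant_finsupp_eigenspace])
  have lower: "V.density K N \<le> ?t" for N
  proof -
    have "cfun.dim (K \<inter> supported_on (V.block N)) \<le> (\<Sum>x\<in>V.block N. l2_sqnorm (eker x))"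
      using invariant_finsupp_eigenspace
      by (intro H.dim_le_trace V.finite_block cfun.subspace_inter subspace_supported_on)
        (auto simp: V.invariant_subspace_def finsupp_eigenspace_eq)
    then show ?thesis unfolding trace_block V.density_def by (simp add: pos_divide_le_eq mult.commute)
  qed
  obtain c where c: "\<And>g w. w \<in> W \<Longrightarrow> nbhd (act g w) \<subseteq> act g ` V.block c"
    using nbhd_uniform by blast
  have upper: "?t \<le> V.density K N + card W * ((?q N - ?q (N - 2 * c)) / ?q N)" if N: "2 * c \<le> N" for N
  proof -
    have "card (V.block N - V.block (N - 2 * c)) = card (V.block N) - card (V.block (N - 2 * c))"
      by (intro card_Diff_subset V.finite_block V.block_mono) simp
    moreover have "card (V.block (N - 2 * c)) \<le> card (V.block N)"
      by (intro card_mono V.finite_block V.block_mono) simp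
    ultimately have b: "real (card (V.block N - V.block (N - 2 * c))) = card W * (?q N - ?q (N - 2 * c))"
      by (simp add: of_nat_diff V.card_block right_diff_distrib)
    have "?q N * ?t \<le> cfun.dim (restrict_to (V.block N) ` H)"
      unfolding trace_block[symmetric] by (rule H.trace_le_dim[OF V.finite_block])
    also have "\<dots> \<le> real (cfun.dim (K \<inter> supported_on (V.block N)) + card (V.block N - V.block (N - 2 * c)))"
      using dim_restricted_eigenspace_le[OF c N] by (simp only: of_nat_le_iff)
    also have "\<dots> = (V.density K N + card W * ((?q N - ?q (N - 2 * c)) / ?q N)) * ?q N"
      unfolding of_nat_add b V.density_def
      by (simp add: distrib_right less_imp_neq[OF cube_vol_pos, symmetric])
    finally show ?thesis by (simp add: mult.commute)
  qed
  have "(\<lambda>N. V.density K N + card W * ((?q N - ?q (N - 2 * c)) / ?q N))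
    \<longlonglongrightarrow> (SUP N. V.density K N) + real (card W) * 0"
    by (intro tendsto_intros lim cube_vol_boundary)
  then have "?t \<le> (SUP N. V.density K N) + real (card W) * 0"
    using upper by (intro LIMSEQ_le_const) auto
  moreover have "(SUP N. V.density K N) \<le> ?t"
    using lower by (intro LIMSEQ_le_const2[OF lim]) auto
  ultimately show ?thesis by simp
qed

end

subsection \<open>Free resolutions\<close>

text \<open>\<open>R\<^sup>n\<close> is identified with the finitely supported functions on \<open>n\<close> copies of \<open>\<int>\<^sup>d\<close>, on which
  \<open>\<int>\<^sup>d\<close> acts with the fundamental domain \<^term>\<open>{..<n} \<times> {0}\<close>.\<close>

definition shift :: "int ^ 'd::finite \<Rightarrow> nat \<times> (int ^ 'd) \<Rightarrow> nat \<times> (int ^ 'd)" where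
  "shift g x = (fst x, g + snd x)"

definition generators :: "nat \<Rightarrow> (nat \<times> (int ^ 'd::finite)) set" where
  "generators n = {..<n} \<times> {0}"

lemma card_generators: "card (generators n) = n"
  by (simp add: generators_def card_cartesian_product)

interpretation shift: free_cofinite_action shift "generators n" for n
  by unfold_locales (auto simp: shift_def generators_def add.assoc)

section \<open>Coordinates on free modules over the group algebra\<close>

definition coefficients :: "(nat \<Rightarrow> (int ^ 'd::finite \<Rightarrow>\<^sub>0 complex)) \<Rightarrow> nat \<times> (int ^ 'd) \<Rightarrow> complex" where
  "coefficients x = (\<lambda>(i, g). Poly_Mapping.lookup (x i) g)"

text \<open>\<open>Abs_poly_mapping\<close> is meaningful only for finite support, so this serves as
  the inverse of \<open>coefficients\<close> on \<open>shift.finsupp n\<close>.\<close>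

definition from_coefficients :: "(nat \<times> (int ^ 'd::finite) \<Rightarrow> complex) \<Rightarrow> nat \<Rightarrow> (int ^ 'd \<Rightarrow>\<^sub>0 complex)" where
  "from_coefficients u = (\<lambda>i. Abs_poly_mapping (\<lambda>g. u (i, g)))"

lemma coefficients_inject: "coefficients x = coefficients y \<longleftrightarrow> x = y"
  by (auto simp: coefficients_def fun_eq_iff intro: poly_mapping_eqI)

lemma coefficients_add: "coefficients (x + y) = coefficients x + coefficients y"
  by (simp add: coefficients_def fun_eq_iff lookup_add)

lemma coefficients_zero: "coefficients 0 = 0"
  by (simp add: coefficients_def fun_eq_iff)

lemma lookup_single_times:
  fixes q :: "'g::ab_group_add \<Rightarrow>\<^sub>0 'a::comm_semiring_1"
  shows "Poly_Mapping.lookup (Poly_Mapping.single g c * q) h = c * Poly_Mapping.lookup q (h - g)"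
proof -
  have eq: "h = l + m \<longleftrightarrow> h - l = m" for l m by (simp add: diff_eq_eq add.commute)
  show ?thesis
    unfolding lookup_mult lookup_single when_mult eq by simp
qed

text \<open>Multiplication by a monomial is a scaled translation of coefficients, so linearity over
  the group algebra contains both complex linearity and equivariance.\<close>

lemma coefficients_single_scale:
  "coefficients (pointwise_scale (Poly_Mapping.single g c) x)
    = pointwise_scale c (translate shift g (coefficients x))"
  by (simp add: coefficients_def fun_eq_iff pointwise_scale_def lookup_single_times translate_def shift_def)

lemma mem_block_shift: "(i, g) \<in> shift.block n N \<longleftrightarrow> i < n \<and> g \<in> cube N"
proof
  assume "i < n \<and> g \<in> cube N"
  then have "shift g (i, 0) \<in> shift.block n N"
    by (intro shift.block_memI) (auto simp: generators_def)
  then show "(i, g) \<in> shift.block n N" by (simp add: shift_def)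
next
  assume "(i, g) \<in> shift.block n N"
  then show "i < n \<and> g \<in> cube N"
    unfolding shift.block_def by (auto simp: generators_def shift_def)
qed

lemma coefficients_mem:
  fixes x :: "nat \<Rightarrow> (int ^ 'd::finite \<Rightarrow>\<^sub>0 complex)"
  assumes "x \<in> free_module n"
  shows "coefficients x \<in> shift.finsupp n"
proof -
  have "finite (\<Union>i<n. Poly_Mapping.keys (x i))" by simp
  then obtain N where N: "(\<Union>i<n. Poly_Mapping.keys (x i)) \<subseteq> cube N"
    using cube_exhausts_finite by blast
  have "coefficients x \<in> supported_on (shift.block n N)"
    unfolding supported_on_def
  proof (intro CollectI allI impI)
    fix z :: "nat \<times> (int ^ 'd)" assume z: "z \<notin> shift.block n N"
    obtain i g where ig: "z = (i, g)" by (cases z)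
    have "Poly_Mapping.lookup (x i) g = 0"
    proof (cases "i < n")
      case True
      then have "g \<notin> Poly_Mapping.keys (x i)" using z N by (auto simp: ig mem_block_shift)
      then show ?thesis by (simp add: in_keys_iff)
    next
      case False
      then show ?thesis using assms by (simp add: free_module_def)
    qed
    then show "coefficients x z = 0" by (simp add: coefficients_def ig)
  qed
  then show ?thesis using shift.supported_block_subset_finsupp by blast
qed

lemma
  assumes "u \<in> shift.finsupp n"
  shows coefficients_from_coefficients: "coefficients (from_coefficients u) = u"
    and from_coefficients_mem: "from_coefficients u \<in> free_module n"
proof -
  obtain N where N: "u \<in> supported_on (shift.block n N)"
    using assms by (auto simp: shift.finsupp_def)
  have u0: "u (i, g) = 0" if "\<not> (i < n \<and> g \<in> cube N)" for i g
    using N that by (simp add: supported_on_def mem_block_shift)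
  have fin: "finite {g. u (i, g) \<noteq> 0}" for i
    by (rule finite_subset[OF _ finite_cube[of N]]) (use u0 in blast)
  show "coefficients (from_coefficients u) = u"
    by (simp add: fun_eq_iff coefficients_def from_coefficients_def lookup_Abs_poly_mapping[OF fin])
  show "from_coefficients u \<in> free_module n"
    using u0 by (simp add: free_module_def from_coefficients_def)
qed

lemma coefficients_image:
  "coefficients ` (free_module n :: (nat \<Rightarrow> (int ^ 'd::finite \<Rightarrow>\<^sub>0 complex)) set) = shift.finsupp n"
proof (rule subset_antisym)
  show "coefficients ` (free_module n :: (nat \<Rightarrow> (int ^ 'd \<Rightarrow>\<^sub>0 complex)) set) \<subseteq> shift.finsupp n"
    by (rule image_subsetI) (rule coefficients_mem)
  show "shift.finsupp n \<subseteq> coefficients ` (free_module n :: (nat \<Rightarrow> (int ^ 'd \<Rightarrow>\<^sub>0 complex)) set)"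
  proof
    fix u :: "nat \<times> (int ^ 'd) \<Rightarrow> complex" assume u: "u \<in> shift.finsupp n"
    show "u \<in> coefficients ` free_module n"
      using imageI[OF from_coefficients_mem[OF u], of coefficients]
      unfolding coefficients_from_coefficients[OF u] .
  qed
qed

lemma from_coefficients_coefficients:
  assumes "x \<in> free_module n"
  shows "from_coefficients (coefficients x) = x"
  using coefficients_from_coefficients[OF coefficients_mem[OF assms]] coefficients_inject by blast

lemma from_coefficients_add:
  assumes "u \<in> shift.finsupp n" "v \<in> shift.finsupp n"
  shows "from_coefficients (u + v) = from_coefficients u + from_coefficients v"
  unfolding coefficients_inject[symmetric] coefficients_add
  using assms cfun.subspace_add[OF shift.subspace_finsupp assms]
  by (simp only: coefficients_from_coefficients[of _ n])

lemma from_coefficients_scale_translate: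
  assumes "u \<in> shift.finsupp n"
  shows "from_coefficients (pointwise_scale c (translate shift g u))
    = pointwise_scale (Poly_Mapping.single g c) (from_coefficients u)"
  unfolding coefficients_inject[symmetric] coefficients_single_scale
  using assms cfun.subspace_scale[OF shift.subspace_finsupp shift.translate_finsupp[OF assms]]
  by (simp only: coefficients_from_coefficients[of _ n])

text \<open>Monomials suffice as scalars: \<open>g = 0\<close> gives complex linearity, and
  \<open>c = 1\<close> gives equivariance.\<close>

lemma equivariant_map_from_coefficients:
  fixes actY :: "int ^ 'd::finite \<Rightarrow> 'y \<Rightarrow> 'y"
    and F :: "(nat \<Rightarrow> (int ^ 'd \<Rightarrow>\<^sub>0 complex)) \<Rightarrow> 'y \<Rightarrow> complex"
  assumes Y: "free_cofinite_action actY WY"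
    and add: "\<And>x y. x \<in> free_module n \<Longrightarrow> y \<in> free_module n \<Longrightarrow> F (x + y) = F x + F y"
    and scale: "\<And>g c x. x \<in> free_module n \<Longrightarrow>
      F (pointwise_scale (Poly_Mapping.single g c) x) = pointwise_scale c (translate actY g (F x))"
    and mem: "\<And>x. x \<in> free_module n \<Longrightarrow> F x \<in> free_cofinite_action.finsupp actY WY"
  shows "equivariant_map shift (generators n) actY WY (\<lambda>u. F (from_coefficients u))"
proof -
  interpret Y: free_cofinite_action actY WY by (rule Y)
  have *: "F (from_coefficients (pointwise_scale c (translate shift g u)))
      = pointwise_scale c (translate actY g (F (from_coefficients u)))"
    if "u \<in> shift.finsupp n" for c g u
    unfolding from_coefficients_scale_translate[OF that] by (rule scale[OF from_coefficients_mem[OF that]])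
  show ?thesis
  proof
    show "clinear_on (shift.finsupp n) (\<lambda>u. F (from_coefficients u))"
      unfolding linear_between_def
    proof (intro conjI ballI allI)
      fix u v :: "nat \<times> (int ^ 'd) \<Rightarrow> complex" assume uv: "u \<in> shift.finsupp n" "v \<in> shift.finsupp n"
      show "F (from_coefficients (u + v)) = F (from_coefficients u) + F (from_coefficients v)"
        unfolding from_coefficients_add[OF uv]
        by (intro add from_coefficients_mem uv)
    next
      fix c and u :: "nat \<times> (int ^ 'd) \<Rightarrow> complex" assume u: "u \<in> shift.finsupp n"
      have "translate shift 0 u = u" by (simp add: translate_def shift_def)
      moreover have "translate actY 0 f = f" for f :: "'y \<Rightarrow> complex"
        by (simp add: translate_def Y.act_zero)
      ultimately show "F (from_coefficients (pointwise_scale c u)) = pointwise_scale c (F (from_coefficients u))"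
        using *[OF u, of c 0] by simp
    qed simp
    fix u :: "nat \<times> (int ^ 'd) \<Rightarrow> complex" assume u: "u \<in> shift.finsupp n"
    show "F (from_coefficients u) \<in> Y.finsupp" by (rule mem[OF from_coefficients_mem[OF u]])
    fix g show "F (from_coefficients (translate shift g u)) = translate actY g (F (from_coefficients u))"
      using *[OF u, of 1 g] by (simp only: cfun.scale_one)
  qed
qed

text \<open>For \<open>c = 0\<close> the monomial has no keys and the defining sum is empty;
  otherwise \<open>g\<close> is its only key.\<close>

lemma group_algebra_scale_single:
  "group_algebra_scale act (Poly_Mapping.single g c) f = pointwise_scale c (translate act g f)"
  by (cases "c = 0") (auto simp: group_algebra_scale_def pointwise_scale_def fun_eq_iff)

section \<open>Telescoping along the resolution\<close>

lemma alternating_sum_telescope: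
  fixes a b :: "nat \<Rightarrow> real"
  assumes "\<And>k. k \<le> n \<Longrightarrow> a (Suc k) + a k = b k"
  shows "a 0 = (\<Sum>k=0..n. (-1) ^ k * b k) + (-1) ^ Suc n * a (Suc n)"
  using assms
proof (induction n)
  case (Suc n)
  then have "a 0 = (\<Sum>k=0..n. (-1) ^ k * b k) + (-1) ^ Suc n * a (Suc n)" by simp
  moreover have "a (Suc n) = b (Suc n) - a (Suc (Suc n))" using Suc.prems[of "Suc n"] by simp
  ultimately show ?case by (simp add: algebra_simps)
qed (use assms[of 0] in simp)

text \<open>Each map of the resolution contributes one rank-nullity relation between densities, and
  exactness identifies every kernel with the next image, so the alternating sum telescopes.\<close>

lemma (in periodic_operator) resolution_density:
  fixes r :: "nat \<Rightarrow> nat"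
    and \<phi> :: "nat \<Rightarrow> (nat \<Rightarrow> ((int ^ 'd) \<Rightarrow>\<^sub>0 complex)) \<Rightarrow> (nat \<Rightarrow> ((int ^ 'd) \<Rightarrow>\<^sub>0 complex))"
    and \<epsilon> :: "(nat \<Rightarrow> ((int ^ 'd) \<Rightarrow>\<^sub>0 complex)) \<Rightarrow> ('v \<Rightarrow> complex)"
  assumes res: "finite_free_resolution n r \<phi> \<epsilon> (group_algebra_scale act) K" and n: "n \<ge> 1"
  shows "(SUP N. V.density K N) = (\<Sum>k=0..n. (-1) ^ k * real (r k))"
proof -
  let ?M = "\<lambda>k. free_module (r k) :: (nat \<Rightarrow> ((int ^ 'd) \<Rightarrow>\<^sub>0 complex)) set"
  have eps: "linear_between pointwise_scale (group_algebra_scale act) (?M 0) K \<epsilon>"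
    and phi: "\<And>k. k \<in> {1..n} \<Longrightarrow> linear_between pointwise_scale pointwise_scale (?M k) (?M (k - 1)) (\<phi> k)"
    and exact: "\<epsilon> ` ?M 0 = K" "\<phi> 1 ` ?M 1 = kernel_on (?M 0) \<epsilon>"
      "\<And>k. k \<in> {1..<n} \<Longrightarrow> \<phi> (k + 1) ` ?M (k + 1) = kernel_on (?M k) (\<phi> k)"
      "kernel_on (?M n) (\<phi> n) = {0}"
    using res unfolding finite_free_resolution_def by auto
  have K_finsupp: "K \<subseteq> V.finsupp" by (simp add: finsupp_eigenspace_eq)
  define \<Phi> where "\<Phi> k u = coefficients (\<phi> k (from_coefficients u))" for k u
  define \<Psi> where "\<Psi> u = \<epsilon> (from_coefficients u)" for u
  interpret eps: equivariant_map shift "generators (r 0)" act W \<Psi>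
    unfolding \<Psi>_def
  proof (rule equivariant_map_from_coefficients[OF V.free_cofinite_action_axioms])
    fix x assume x: "x \<in> ?M 0"
    show "\<epsilon> x \<in> V.finsupp" using linear_betweenD(1)[OF eps x] K_finsupp by blast
    show "\<epsilon> (pointwise_scale (Poly_Mapping.single g c) x) = pointwise_scale c (translate act g (\<epsilon> x))" for g c
      unfolding group_algebra_scale_single[symmetric] by (rule linear_betweenD(3)[OF eps x])
  qed (rule linear_betweenD(2)[OF eps])
  have phi_eq: "equivariant_map shift (generators (r k)) shift (generators (r (k - 1))) (\<Phi> k)"
    if k: "k \<in> {1..n}" for k
    unfolding \<Phi>_def
  proof (rule equivariant_map_from_coefficients[OF shift.free_cofinite_action_axioms])
    fix x assume x: "x \<in> ?M k"
    show "coefficients (\<phi> k x) \<in> shift.finsupp (r (k - 1))"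
      by (rule coefficients_mem[OF linear_betweenD(1)[OF phi[OF k] x]])
    show "coefficients (\<phi> k (pointwise_scale (Poly_Mapping.single g c) x))
        = pointwise_scale c (translate shift g (coefficients (\<phi> k x)))" for g c
      unfolding linear_betweenD(3)[OF phi[OF k] x] by (rule coefficients_single_scale)
    fix y assume y: "y \<in> ?M k"
    show "coefficients (\<phi> k (x + y)) = coefficients (\<phi> k x) + coefficients (\<phi> k y)"
      unfolding linear_betweenD(2)[OF phi[OF k] x y] by (rule coefficients_add)
  qed
  \<comment> \<open>These transfer facts are polymorphic in the codomain, so they apply both to
    \<open>\<epsilon>\<close> and to \<open>\<phi> k\<close> followed by
    \<open>coefficients\<close>.\<close>
  have image: "(\<lambda>u. F (from_coefficients u)) ` shift.finsupp m = F ` free_module m"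
    for F :: "(nat \<Rightarrow> ((int ^ 'd) \<Rightarrow>\<^sub>0 complex)) \<Rightarrow> 'b" and m
    unfolding coefficients_image[symmetric] image_image
    by (intro image_cong refl) (simp add: from_coefficients_coefficients)
  have kern: "kernel_on (shift.finsupp m) (\<lambda>u. F (from_coefficients u)) = coefficients ` kernel_on (free_module m) F"
    for F :: "(nat \<Rightarrow> ((int ^ 'd) \<Rightarrow>\<^sub>0 complex)) \<Rightarrow> 'b::zero" and m
    unfolding coefficients_image[symmetric] kernel_on_def
    by (auto simp: from_coefficients_coefficients)
  have coef0: "coefficients x = 0 \<longleftrightarrow> x = 0" for x :: "nat \<Rightarrow> ((int ^ 'd) \<Rightarrow>\<^sub>0 complex)"
    using coefficients_inject[of x 0] by (simp only: coefficients_zero)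
  have img_eps: "\<Psi> ` shift.finsupp (r 0) = K"
    unfolding \<Psi>_def image exact(1) ..
  have img_phi: "\<Phi> k ` shift.finsupp (r k) = coefficients ` (\<phi> k ` ?M k)" for k
    unfolding \<Phi>_def image[of "\<lambda>x. coefficients (\<phi> k x)"] image_image ..
  have kern_eps: "kernel_on (shift.finsupp (r 0)) \<Psi> = \<Phi> 1 ` shift.finsupp (r 1)"
    unfolding \<Psi>_def kern img_phi exact(2) ..
  have kern_phi': "kernel_on (shift.finsupp (r k)) (\<Phi> k) = coefficients ` kernel_on (?M k) (\<phi> k)" for k
    unfolding \<Phi>_def kern[of _ "\<lambda>x. coefficients (\<phi> k x)"] by (simp add: kernel_on_def coef0)
  have kern_phi: "kernel_on (shift.finsupp (r k)) (\<Phi> k) = \<Phi> (k + 1) ` shift.finsupp (r (k + 1))"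
    if "k \<in> {1..<n}" for k
    unfolding kern_phi' img_phi exact(3)[OF that] ..
  have kern_last: "kernel_on (shift.finsupp (r n)) (\<Phi> n) = {0}"
    unfolding kern_phi' exact(4) by (simp add: coefficients_zero)
  \<comment> \<open>\<open>a k\<close> is the density of the image of the map out of the
    \<open>k\<close>-th free module, where the map with index 0 is \<open>\<epsilon>\<close> with
    image \<open>K\<close>. Beyond \<open>n\<close> the value 0 is the density of the zero kernel of
    the last map.\<close>
  define a where "a k = (if k = 0 then SUP N. V.density K N
    else if k \<le> n then SUP N. shift.density (r (k - 1)) (\<Phi> k ` shift.finsupp (r k)) N
    else 0)" for k
  have step: "a (Suc k) + a k = real (r k)" if k: "k \<le> n" for k
  proof (cases "k = 0")
    case True
    have "a (Suc k) = (SUP N. shift.density (r 0) (kernel_on (shift.finsupp (r 0)) \<Psi>) N)"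
      unfolding kern_eps using True n by (simp add: a_def)
    moreover have "a k = (SUP N. V.density (\<Psi> ` shift.finsupp (r 0)) N)"
      unfolding img_eps using True by (simp add: a_def)
    ultimately show ?thesis
      using eps.density_rank_nullity True by (simp add: card_generators)
  next
    case False
    then have k1: "k \<in> {1..n}" using k by simp
    interpret phi: equivariant_map shift "generators (r k)" shift "generators (r (k - 1))" "\<Phi> k"
      by (rule phi_eq[OF k1])
    have "a k = (SUP N. shift.density (r (k - 1)) (\<Phi> k ` shift.finsupp (r k)) N)"
      using k1 by (simp add: a_def)
    moreover have "a (Suc k) = (SUP N. shift.density (r k) (kernel_on (shift.finsupp (r k)) (\<Phi> k)) N)"
    proof (cases "k = n")
      case True
      have "cfun.dim ({0} \<inter> supported_on A) = 0" for A :: "(nat \<times> (int ^ 'd)) set"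
        using cfun.dim_le_card[of "{0} \<inter> supported_on A" "{}"] by simp
      then have "shift.density (r k) (kernel_on (shift.finsupp (r k)) (\<Phi> k)) N = 0" for N
        unfolding True kern_last shift.density_def by simp
      then show ?thesis using True by (simp add: a_def)
    next
      case False
      then have "k \<in> {1..<n}" using k1 by simp
      then show ?thesis unfolding kern_phi[OF \<open>k \<in> {1..<n}\<close>] by (simp add: a_def)
    qed
    ultimately show ?thesis
      using phi.density_rank_nullity by (simp add: card_generators)
  qed
  have "a 0 = (\<Sum>k=0..n. (-1) ^ k * real (r k)) + (-1) ^ Suc n * a (Suc n)"
    by (rule alternating_sum_telescope) (rule step)
  \<comment> \<open>The remainder vanishes because \<open>a (Suc n)\<close> is 0.\<close>
  then show ?thesis by (simp add: a_def)
qed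

theorem theorem1p1:
  fixes E :: "('v \<times> 'v) set"
    and act :: "int ^ 'd::finite \<Rightarrow> 'v \<Rightarrow> 'v"
    and D :: "('v \<Rightarrow> complex) \<Rightarrow> 'v \<Rightarrow> complex"
    and W :: "'v set"
    and lam :: real
    and r :: "nat \<Rightarrow> nat"
    and \<phi> :: "nat \<Rightarrow> (nat \<Rightarrow> ((int ^ 'd) \<Rightarrow>\<^sub>0 complex)) \<Rightarrow> (nat \<Rightarrow> ((int ^ 'd) \<Rightarrow>\<^sub>0 complex))"
    and \<epsilon> :: "(nat \<Rightarrow> ((int ^ 'd) \<Rightarrow>\<^sub>0 complex)) \<Rightarrow> ('v \<Rightarrow> complex)"
  assumes "periodic_graph E act"
    and "fundamental_domain act W"
    and "l2_operator D"
    and "finite_order E D"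
    and "commutes_with_action act D"
    and "complex_of_real lam \<in> point_spectrum D"
    and "finite_free_resolution CARD('d) r \<phi> \<epsilon>
           (group_algebra_scale act) (finsupp_eigenspace D (complex_of_real lam))"
  shows "density_of_states D W (complex_of_real lam) =
           1 / of_nat (card (orbits act)) * (\<Sum>k=0..CARD('d). (-1) ^ k * of_nat (r k))"
proof -
  interpret periodic_graph E act by (rule assms(1))
  interpret periodic_operator E act W D "complex_of_real lam"
    by unfold_locales (rule assms)+
  \<comment> \<open>The length \<open>CARD('d)\<close> is at least 1 because the index type is
    finite and nonempty.\<close>
  have "(SUP N. V.density K N) = (\<Sum>k=0..CARD('d). (-1) ^ k * real (r k))"
    by (rule resolution_density[OF assms(7)]) (simp add: Suc_le_eq)
  then show ?thesis
    unfolding density_of_states_eq trace_eq_density card_W by simp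
qed

end
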